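(* Let $(W_1,I_1)$ and $(W_2,I_2)$ be Coxeter groups and let $c=(J_1,J_2,\delta)$, $c'=(J'_1,J'_2,\delta')$ be admissible triples for $W_1\times W_2$. Let $\pi:W_1\times W_2\to {}^{J'_1}W_1\times W_2^{J_2}$ be the map defined in the context, and for $(w_1, w_2) \in {}^{J'_1} W_1 \times W_2^{J_2}$ put $[w_1,w_2,c,c']=\pi^{-1}(w_1,w_2)$ and write $I(w_1,w_2,c,c')$ for the largest $K\subset J_1$ with $w_1(K)\subset J'_1$ and $\delta'(w_1(K))=w_2(\delta(K))$. Then for every $(w_1, w_2) \in {}^{J'_1} W_1 \times W_2^{J_2}$: (1) $[w_1, w_2, c, c']=W_{c'} \,(w_1 W_{I(w_1, w_2, c, c')}\times\{ w_2\})\, W_c$. (2) Define an automorphism $\sigma: W_{I(w_1, w_2, c, c')} \rightarrow W_{I(w_1, w_2, c, c')}$ by $\sigma(w)=\delta^{-1} \bigl(w_2^{-1} \delta'(w_1 w w_1^{-1}) w_2 \bigr)$. Then the map $W_{I(w_1, w_2, c, c')} \rightarrow W_1 \times W_2$, $w \mapsto (w_1 w, w_2)$, induces a bijection between the $\sigma$-twisted conjugacy classes of $W_{I(w_1, w_2, c, c')}$ and the double cosets $W_{c'} \backslash [w_1, w_2, c, c'] /W_c$.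
   Context: Coxeter groups $(W,I)$ have finite $I$; subsets of $I$ are identified with sets of simple reflections, $W_J$ is the standard parabolic subgroup generated by $J$, $W^J$ (resp. ${}^JW$) is the set of minimal length representatives of $W/W_J$ (resp. $W_J\backslash W$), $w(K)=wK=wKw^{-1}$, and $\min(X)$ denotes the unique minimal length element of a coset $X$ of a standard parabolic subgroup. For an automorphism $\sigma$ of a group $W$, the $\sigma$-twisted conjugacy classes are the orbits of $w\cdot w'=ww'\sigma(w)^{-1}$. An admissible triple for $W_1\times W_2$ is $c=(J_1,J_2,\delta)$ with $J_1\subset I_1$, $J_2\subset I_2$ and $\delta:W_{J_1}\to W_{J_2}$ a group isomorphism with $\delta(J_1)=J_2$. Set $W_c=\{(w,\delta(w)); w\in W_{J_1}\}$. Definition of $\pi$. To $(w_1,w_2)\in W_1\times W_2$ associate inductively $J_1^{(n)}\subset J_1$, $J_2^{\prime(n)}\subset J'_2$, $u_1^{(n)},w_1^{(n)},v_1^{(n)}\in W_1$ and $u_2^{(n)},w_2^{(n)},v_2^{(n)}\in W_2$ as follows. For $n=0$: $J_1^{(0)}=J_1$, $u_1^{(0)}=\min(W_{J'_1}w_1)$, $w_1^{(0)}=\min(u_1^{(0)}W_{J_1})$, $v_1^{(0)}=w_1(u_1^{(0)})^{-1}$ (an element of $W_{J'_1}$), $J_2^{\prime(0)}=\delta'(w_1^{(0)}J_1\cap J'_1)$, $u_2^{(0)}=\min(\delta'(v_1^{(0)})^{-1}w_2W_{J_2})$, $w_2^{(0)}=\min(W_{J_2^{\prime(0)}}u_2^{(0)})$,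 $v_2^{(0)}=(u_2^{(0)})^{-1}\delta'(v_1^{(0)})^{-1}w_2$ (an element of $W_{J_2}$). For $n\ge 1$: $J_1^{(n)}=\delta^{-1}\bigl((w_2^{(n-1)})^{-1}J_2^{\prime(n-1)}\cap J_2\bigr)$, $u_1^{(n)}=\min\bigl(W_{J'_1}u_1^{(n-1)}\delta^{-1}(v_2^{(n-1)})^{-1}\bigr)$, $w_1^{(n)}=\min(u_1^{(n)}W_{J_1^{(n)}})$, $v_1^{(n)}=u_1^{(n-1)}\delta^{-1}(v_2^{(n-1)})^{-1}(u_1^{(n)})^{-1}$, $J_2^{\prime(n)}=\delta'(w_1^{(n)}J_1^{(n)}\cap J'_1)$, $u_2^{(n)}=\min\bigl(\delta'(v_1^{(n)})^{-1}u_2^{(n-1)}W_{J_2}\bigr)$, $w_2^{(n)}=\min(W_{J_2^{\prime(n)}}u_2^{(n)})$, $v_2^{(n)}=(u_2^{(n)})^{-1}\delta'(v_1^{(n)})^{-1}u_2^{(n-1)}$. The sequence $(w_1^{(n)},w_2^{(n)})$ is eventually constant with eventual value in ${}^{J'_1}W_1\times W_2^{J_2}$, and $\pi(w_1,w_2)$ is by definition this eventual value. *)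

theory Defs
  imports "HOL-Algebra.Generated_Groups" "HOL-Algebra.Group_Action"
begin

definition coxeter_matrix :: "'a set \<Rightarrow> ('a \<Rightarrow> 'a \<Rightarrow> nat) \<Rightarrow> bool" where
  "coxeter_matrix I m \<longleftrightarrow>
     (\<forall>s\<in>I. m s s = 1) \<and>
     (\<forall>s\<in>I. \<forall>t\<in>I. s \<noteq> t \<longrightarrow> m s t = m t s \<and> m s t \<noteq> 1)"

text \<open>The value \<open>m s t = 0\<close> encodes \<open>m(s,t) = \<infinity>\<close>: the corresponding relator is
  the empty word, so it imposes no relation.\<close>

definition coxeter_move :: "'a set \<Rightarrow> ('a \<Rightarrow> 'a \<Rightarrow> nat) \<Rightarrow> 'a list \<Rightarrow> 'a list \<Rightarrow> bool" where
  "coxeter_move I m xs ys \<longleftrightarrow>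
     (\<exists>us\<in>lists I. \<exists>vs\<in>lists I. \<exists>s\<in>I. \<exists>t\<in>I.
        xs = us @ vs \<and> ys = us @ concat (replicate (m s t) [s, t]) @ vs)"

definition word_value :: "('a, 'k) monoid_scheme \<Rightarrow> 'a list \<Rightarrow> 'a" where
  "word_value W xs = foldr (\<otimes>\<^bsub>W\<^esub>) xs \<one>\<^bsub>W\<^esub>"

text \<open>The locale says that \<open>W\<close> is the group presented by the generators \<open>I\<close> and the relations
  \<open>(st)\<^bsup>m(s,t)\<^esup> = 1\<close>. Since \<open>m s s = 1\<close> makes the word \<open>ss\<close> a relator, every generator is its
  own inverse, and words in \<open>I\<close> without formal inverses suffice to write down the presentation:
  two words have the same value exactly if they are connected by insertions and deletions of
  relators.\<close>

locale coxeter_group = group W for W (structure) +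
  fixes I
  assumes finite_generators: "finite I"
    and generators_closed: "I \<subseteq> carrier W"
    and generated: "generate W I = carrier W"
    and presented: "\<exists>m. coxeter_matrix I m \<and>
      (\<forall>xs\<in>lists I. \<forall>ys\<in>lists I.
         word_value W xs = word_value W ys \<longleftrightarrow> equivclp (coxeter_move I m) xs ys)"

definition coxeter_length :: "('a, 'k) monoid_scheme \<Rightarrow> 'a set \<Rightarrow> 'a \<Rightarrow> nat" where
  "coxeter_length W I w = (LEAST n. \<exists>xs\<in>lists I. length xs = n \<and> word_value W xs = w)"

definition coset_min :: "('a, 'k) monoid_scheme \<Rightarrow> 'a set \<Rightarrow> 'a set \<Rightarrow> 'a" where
  "coset_min W I C =
     (THE x. x \<in> C \<and> (\<forall>y\<in>C. coxeter_length W I x \<le> coxeter_length W I y))"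

text \<open>\<open>parabolic W J\<close> is \<open>W\<^sub>J\<close>, as a group.\<close>

abbreviation parabolic :: "('a, 'k) monoid_scheme \<Rightarrow> 'a set \<Rightarrow> ('a, 'k) monoid_scheme" where
  "parabolic W J \<equiv> W\<lparr>carrier := generate W J\<rparr>"

text \<open>The sets \<open>W\<^sup>J\<close> and \<open>\<^sup>JW\<close> of minimal length representatives of \<open>W/W\<^sub>J\<close> and \<open>W\<^sub>J\W\<close>.\<close>

definition min_reps_right_quotient ::
  "('a, 'k) monoid_scheme \<Rightarrow> 'a set \<Rightarrow> 'a set \<Rightarrow> 'a set" where
  "min_reps_right_quotient W I J =
     {w \<in> carrier W. \<forall>y \<in> w <#\<^bsub>W\<^esub> generate W J. coxeter_length W I w \<le> coxeter_length W I y}"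

definition min_reps_left_quotient ::
  "('a, 'k) monoid_scheme \<Rightarrow> 'a set \<Rightarrow> 'a set \<Rightarrow> 'a set" where
  "min_reps_left_quotient W I J =
     {w \<in> carrier W. \<forall>y \<in> generate W J #>\<^bsub>W\<^esub> w. coxeter_length W I w \<le> coxeter_length W I y}"

definition conj_set :: "('a, 'k) monoid_scheme \<Rightarrow> 'a \<Rightarrow> 'a set \<Rightarrow> 'a set" where
  "conj_set W w K = (\<lambda>k. w \<otimes>\<^bsub>W\<^esub> k \<otimes>\<^bsub>W\<^esub> inv\<^bsub>W\<^esub> w) ` K"

type_synonym ('a, 'b) triple = "'a set \<times> 'b set \<times> ('a \<Rightarrow> 'b)"

text \<open>Only the values of \<open>\<delta>\<close> on \<open>W\<^sub>J\<^sub>1\<close> are meaningful.\<close>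

fun admissible_triple ::
  "('a, 'k) monoid_scheme \<Rightarrow> 'a set \<Rightarrow> ('b, 'l) monoid_scheme \<Rightarrow> 'b set \<Rightarrow> ('a, 'b) triple \<Rightarrow> bool"
  where
  "admissible_triple W1 I1 W2 I2 (J1, J2, \<delta>) \<longleftrightarrow>
     J1 \<subseteq> I1 \<and> J2 \<subseteq> I2 \<and> \<delta> \<in> iso (parabolic W1 J1) (parabolic W2 J2) \<and> \<delta> ` J1 = J2"

text \<open>The subgroup \<open>W\<^sub>c\<close>.\<close>

fun triple_graph :: "('a, 'k) monoid_scheme \<Rightarrow> ('a, 'b) triple \<Rightarrow> ('a \<times> 'b) set" where
  "triple_graph W1 (J1, J2, \<delta>) = {(w, \<delta> w) | w. w \<in> generate W1 J1}"

fun triple_inv :: "('a, 'k) monoid_scheme \<Rightarrow> ('a, 'b) triple \<Rightarrow> 'b \<Rightarrow> 'a" where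
  "triple_inv W1 (J1, J2, \<delta>) = inv_into (generate W1 J1) \<delta>"

text \<open>The data \<open>J\<^sub>1\<^bsup>(n)\<^esup>, u\<^sub>1\<^bsup>(n)\<^esup>, w\<^sub>1\<^bsup>(n)\<^esup>, v\<^sub>1\<^bsup>(n)\<^esup>, J'\<^sub>2\<^bsup>(n)\<^esup>, u\<^sub>2\<^bsup>(n)\<^esup>, w\<^sub>2\<^bsup>(n)\<^esup>, v\<^sub>2\<^bsup>(n)\<^esup>\<close> of one stage of the
  recursion.\<close>

record ('a, 'b) stage =
  stage_J1 :: "'a set"
  stage_u1 :: 'a
  stage_w1 :: 'a
  stage_v1 :: 'a
  stage_J2 :: "'b set"
  stage_u2 :: 'b
  stage_w2 :: 'b
  stage_v2 :: 'b

text \<open>Given \<open>J = J\<^sub>1\<^bsup>(n)\<^esup>\<close>, the remaining data of stage \<open>n\<close> are obtained by the same formulas for all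
  \<open>n\<close>, from \<open>(x, y) = (w\<^sub>1, w\<^sub>2)\<close> if \<open>n = 0\<close> and from
  \<open>(x, y) = (u\<^sub>1\<^bsup>(n-1)\<^esup> \<delta>\<^bsup>-1\<^esup>(v\<^sub>2\<^bsup>(n-1)\<^esup>)\<^bsup>-1\<^esup>, u\<^sub>2\<^bsup>(n-1)\<^esup>)\<close> if \<open>n \<ge> 1\<close>.\<close>

fun make_stage ::
  "('a, 'k) monoid_scheme \<Rightarrow> 'a set \<Rightarrow> ('b, 'l) monoid_scheme \<Rightarrow> 'b set \<Rightarrow>
   ('a, 'b) triple \<Rightarrow> ('a, 'b) triple \<Rightarrow> 'a set \<Rightarrow> 'a \<Rightarrow> 'b \<Rightarrow> ('a, 'b) stage" where
  "make_stage W1 I1 W2 I2 (J1, J2, \<delta>) (J1', J2', \<delta>') J x y =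
     (let u1 = coset_min W1 I1 (generate W1 J1' #>\<^bsub>W1\<^esub> x);
          w1 = coset_min W1 I1 (u1 <#\<^bsub>W1\<^esub> generate W1 J);
          v1 = x \<otimes>\<^bsub>W1\<^esub> inv\<^bsub>W1\<^esub> u1;
          J' = \<delta>' ` (conj_set W1 w1 J \<inter> J1');
          u2 = coset_min W2 I2 ((inv\<^bsub>W2\<^esub> (\<delta>' v1) \<otimes>\<^bsub>W2\<^esub> y) <#\<^bsub>W2\<^esub> generate W2 J2);
          w2 = coset_min W2 I2 (generate W2 J' #>\<^bsub>W2\<^esub> u2);
          v2 = inv\<^bsub>W2\<^esub> u2 \<otimes>\<^bsub>W2\<^esub> inv\<^bsub>W2\<^esub> (\<delta>' v1) \<otimes>\<^bsub>W2\<^esub> y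
      in \<lparr>stage_J1 = J, stage_u1 = u1, stage_w1 = w1, stage_v1 = v1,
          stage_J2 = J', stage_u2 = u2, stage_w2 = w2, stage_v2 = v2\<rparr>)"

fun next_stage ::
  "('a, 'k) monoid_scheme \<Rightarrow> 'a set \<Rightarrow> ('b, 'l) monoid_scheme \<Rightarrow> 'b set \<Rightarrow>
   ('a, 'b) triple \<Rightarrow> ('a, 'b) triple \<Rightarrow> ('a, 'b) stage \<Rightarrow> ('a, 'b) stage" where
  "next_stage W1 I1 W2 I2 (J1, J2, \<delta>) c' S =
     make_stage W1 I1 W2 I2 (J1, J2, \<delta>) c'
       (triple_inv W1 (J1, J2, \<delta>) `
          (conj_set W2 (inv\<^bsub>W2\<^esub> (stage_w2 S)) (stage_J2 S) \<inter> J2))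
       (stage_u1 S \<otimes>\<^bsub>W1\<^esub> inv\<^bsub>W1\<^esub> (triple_inv W1 (J1, J2, \<delta>) (stage_v2 S)))
       (stage_u2 S)"

primrec stage_seq ::
  "('a, 'k) monoid_scheme \<Rightarrow> 'a set \<Rightarrow> ('b, 'l) monoid_scheme \<Rightarrow> 'b set \<Rightarrow>
   ('a, 'b) triple \<Rightarrow> ('a, 'b) triple \<Rightarrow> 'a \<times> 'b \<Rightarrow> nat \<Rightarrow> ('a, 'b) stage" where
  "stage_seq W1 I1 W2 I2 c c' p 0 = make_stage W1 I1 W2 I2 c c' (fst c) (fst p) (snd p)"
| "stage_seq W1 I1 W2 I2 c c' p (Suc n) =
     next_stage W1 I1 W2 I2 c c' (stage_seq W1 I1 W2 I2 c c' p n)"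

definition stable_value ::
  "('a, 'k) monoid_scheme \<Rightarrow> 'a set \<Rightarrow> ('b, 'l) monoid_scheme \<Rightarrow> 'b set \<Rightarrow>
   ('a, 'b) triple \<Rightarrow> ('a, 'b) triple \<Rightarrow> 'a \<times> 'b \<Rightarrow> 'a \<times> 'b" where
  "stable_value W1 I1 W2 I2 c c' p =
     (THE q. \<exists>N. \<forall>n\<ge>N.
        (stage_w1 (stage_seq W1 I1 W2 I2 c c' p n),
         stage_w2 (stage_seq W1 I1 W2 I2 c c' p n)) = q)"

text \<open>The map \<open>\<pi>\<close> is \<open>stable_value\<close>, and \<open>fiber\<close> is \<open>[w\<^sub>1, w\<^sub>2, c, c'] = \<pi>\<^bsup>-1\<^esup>(w\<^sub>1, w\<^sub>2)\<close>.\<close>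

definition fiber ::
  "('a, 'k) monoid_scheme \<Rightarrow> 'a set \<Rightarrow> ('b, 'l) monoid_scheme \<Rightarrow> 'b set \<Rightarrow>
   ('a, 'b) triple \<Rightarrow> ('a, 'b) triple \<Rightarrow> 'a \<Rightarrow> 'b \<Rightarrow> ('a \<times> 'b) set" where
  "fiber W1 I1 W2 I2 c c' w1 w2 =
     {p \<in> carrier W1 \<times> carrier W2. stable_value W1 I1 W2 I2 c c' p = (w1, w2)}"

text \<open>The set \<open>I(w\<^sub>1, w\<^sub>2, c, c')\<close>, the greatest one with respect to inclusion.\<close>

fun stable_subset ::
  "('a, 'k) monoid_scheme \<Rightarrow> ('b, 'l) monoid_scheme \<Rightarrow>
   ('a, 'b) triple \<Rightarrow> ('a, 'b) triple \<Rightarrow> 'a \<Rightarrow> 'b \<Rightarrow> 'a set" where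
  "stable_subset W1 W2 (J1, J2, \<delta>) (J1', J2', \<delta>') w1 w2 =
     (GREATEST K. K \<subseteq> J1 \<and> conj_set W1 w1 K \<subseteq> J1' \<and>
        \<delta>' ` conj_set W1 w1 K = conj_set W2 w2 (\<delta> ` K))"

fun twist ::
  "('a, 'k) monoid_scheme \<Rightarrow> ('b, 'l) monoid_scheme \<Rightarrow>
   ('a, 'b) triple \<Rightarrow> ('a, 'b) triple \<Rightarrow> 'a \<Rightarrow> 'b \<Rightarrow> 'a \<Rightarrow> 'a" where
  "twist W1 W2 (J1, J2, \<delta>) (J1', J2', \<delta>') w1 w2 w =
     triple_inv W1 (J1, J2, \<delta>)
       (inv\<^bsub>W2\<^esub> w2 \<otimes>\<^bsub>W2\<^esub> \<delta>' (w1 \<otimes>\<^bsub>W1\<^esub> w \<otimes>\<^bsub>W1\<^esub> inv\<^bsub>W1\<^esub> w1) \<otimes>\<^bsub>W2\<^esub> w2)"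

definition twisted_conjugacy_classes ::
  "('a, 'k) monoid_scheme \<Rightarrow> ('a \<Rightarrow> 'a) \<Rightarrow> 'a set set" where
  "twisted_conjugacy_classes W \<sigma> =
     orbits W (carrier W) (\<lambda>w w'. w \<otimes>\<^bsub>W\<^esub> w' \<otimes>\<^bsub>W\<^esub> inv\<^bsub>W\<^esub> (\<sigma> w))"

definition double_coset :: "('a, 'k) monoid_scheme \<Rightarrow> 'a set \<Rightarrow> 'a \<Rightarrow> 'a set \<Rightarrow> 'a set" where
  "double_coset W H x K = H <#>\<^bsub>W\<^esub> {x} <#>\<^bsub>W\<^esub> K"

end

theory Submission
  imports Defs
begin

text \<open>Let \<open>W\<^sub>c\<^sub>' \<times> W\<^sub>c\<close> act on \<open>W\<^sub>1 \<times> W\<^sub>2\<close>. The inputs of the successive stages of the recursion all lie in the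
  orbit of the initial pair, and the sets \<open>J\<^sub>1\<^bsup>(n)\<^esup>\<close> decrease, so they become constant; comparing
  cardinalities, the final set \<open>K\<close> then satisfies \<open>w\<^sub>1(K) \<subseteq> J'\<^sub>1\<close> and \<open>\<delta>'(w\<^sub>1(K)) = w\<^sub>2(\<delta>(K))\<close>, and the orbit
  meets \<open>w\<^sub>1 W\<^sub>K \<times> {w\<^sub>2}\<close>. Conversely, for a pair in the orbit of a point of \<open>w\<^sub>1 W\<^sub>L \<times> {w\<^sub>2}\<close>, where \<open>L\<close> satisfies the same
  conditions, every stage keeps \<open>L \<subseteq> J\<^sub>1\<^bsup>(n)\<^esup>\<close>, \<open>w\<^sub>1 \<in> w\<^sub>1\<^bsup>(n)\<^esup> W\<close> and \<open>w\<^sub>2 \<in> W w\<^sub>2\<^bsup>(n)\<^esup>\<close> for the parabolic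
  subgroups \<open>W\<close> of that stage, which forces the eventual value to be \<open>(w\<^sub>1, w\<^sub>2)\<close>. The same induction
  confines the pairs carrying \<open>(w\<^sub>1 z, w\<^sub>2)\<close> to \<open>(w\<^sub>1 z', w\<^sub>2)\<close> to the final parabolic subgroup, and there they
  act by twisted conjugation. Each step rests on the fact that \<open>W\<^sub>K \<inter> d W\<^sub>J d\<^sup>-\<^sup>1\<close> is the parabolic
  subgroup of \<open>K \<inter> d J d\<^sup>-\<^sup>1\<close> when \<open>d\<close> is minimal in \<open>W\<^sub>K d W\<^sub>J\<close>, which follows from the exchange condition.\<close>

section \<open>The exchange condition and minimal coset representatives\<close>

text \<open>For a word s1 ... sn, entry i is s1 ... s(i-1) si s(i-1) ... s1, the reflection whose
  product from the left deletes the i-th letter. The list keeps repetitions, because their parity is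
  the invariant behind the exchange condition.\<close>

fun reflections :: "('a, 'k) monoid_scheme \<Rightarrow> 'a list \<Rightarrow> 'a list" where
  "reflections W [] = []"
| "reflections W (s # xs) = s # map (\<lambda>t. s \<otimes>\<^bsub>W\<^esub> t \<otimes>\<^bsub>W\<^esub> s) (reflections W xs)"

lemma (in group) inv_cancel_left [simp]:
  assumes "x \<in> carrier G" "y \<in> carrier G"
  shows "inv x \<otimes> (x \<otimes> y) = y" "x \<otimes> (inv x \<otimes> y) = y"
  using assms by (simp_all flip: m_assoc)

lemma word_value_Nil [simp]: "word_value W [] = \<one>\<^bsub>W\<^esub>"
  and word_value_Cons [simp]: "word_value W (s # xs) = s \<otimes>\<^bsub>W\<^esub> word_value W xs"
  by (simp_all add: word_value_def)

section \<open>Words, their values, and the subgroups generated by simple reflections\<close>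

context coxeter_group
begin

abbreviation len :: "'a \<Rightarrow> nat" where "len \<equiv> coxeter_length W I"
abbreviation val :: "'a list \<Rightarrow> 'a" where "val \<equiv> word_value W"
abbreviation gen :: "'a set \<Rightarrow> 'a set" where "gen \<equiv> generate W"
abbreviation left_reps :: "'a set \<Rightarrow> 'a set" where "left_reps \<equiv> min_reps_left_quotient W I"
abbreviation right_reps :: "'a set \<Rightarrow> 'a set" where "right_reps \<equiv> min_reps_right_quotient W I"

lemma I_closed [simp, intro]: "s \<in> I \<Longrightarrow> s \<in> carrier W"
  using generators_closed by auto

lemma word_value_closed [simp, intro]: "xs \<in> lists I \<Longrightarrow> val xs \<in> carrier W"
  by (induction xs) auto

lemma word_value_append:
  "xs \<in> lists I \<Longrightarrow> ys \<in> lists I \<Longrightarrow> val (xs @ ys) = val xs \<otimes> val ys"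
  by (induction xs) (auto simp: m_assoc)

lemma generator_involution [simp]:
  assumes "s \<in> I" shows "s \<otimes> s = \<one>"
proof -
  obtain m where m: "coxeter_matrix I m" and
    p: "\<forall>xs\<in>lists I. \<forall>ys\<in>lists I. val xs = val ys \<longleftrightarrow> equivclp (coxeter_move I m) xs ys"
    using presented by auto
  have "coxeter_move I m [] [s, s]"
    unfolding coxeter_move_def using assms m
    by (auto simp: coxeter_matrix_def intro!: bexI[of _ "[]"] bexI[of _ s])
  moreover have "[] \<in> lists I" "[s, s] \<in> lists I" using assms by auto
  ultimately have "val [] = val [s, s]" using p r_into_equivclp by metis
  from this[symmetric] show ?thesis using assms by simp
qed

lemma generator_inv [simp]: "s \<in> I \<Longrightarrow> inv s = s"
  by (simp add: inv_equality)

lemma generator_cancel [simp]: "s \<in> I \<Longrightarrow> x \<in> carrier W \<Longrightarrow> s \<otimes> (s \<otimes> x) = x"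
  by (simp add: m_assoc[symmetric])

lemma word_value_rev: "xs \<in> lists I \<Longrightarrow> val (rev xs) = inv (val xs)"
  by (induction xs) (simp_all add: word_value_append inv_mult_group lists_eq_set)

text \<open>Simple reflections are involutions, so inverses of generators need no letters of their
  own.\<close>

lemma gen_eq_words:
  assumes "K \<subseteq> I" shows "gen K = val ` lists K"
proof
  show "gen K \<subseteq> val ` lists K"
  proof
    fix x assume "x \<in> gen K"
    thus "x \<in> val ` lists K"
    proof induction
      case one thus ?case by (auto intro: image_eqI[of _ _ "[]"])
    next
      case (incl s) thus ?case using assms by (auto intro!: image_eqI[of _ _ "[s]"])
    next
      case (inv s)
      thus ?case using assms
        by (auto intro!: image_eqI[of _ _ "[s]"] simp: subset_iff)
    next
      case (eng x y)
      then obtain xs ys where *: "xs \<in> lists K" "ys \<in> lists K" "x = val xs" "y = val ys" by auto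
      with assms have "xs \<in> lists I" "ys \<in> lists I" by auto
      with * show ?case by (simp add: image_eqI[of _ _ "xs @ ys"] word_value_append)
    qed
  qed
  have "val xs \<in> gen K" if "xs \<in> lists K" for xs
    using that by induction (auto intro: generate.intros)
  thus "val ` lists K \<subseteq> gen K" by auto
qed

lemma gen_subgroup: "K \<subseteq> I \<Longrightarrow> subgroup (gen K) W"
  using generators_closed by (intro generate_is_subgroup) auto

lemma gen_closed: "K \<subseteq> I \<Longrightarrow> k \<in> gen K \<Longrightarrow> k \<in> carrier W"
  by (meson gen_subgroup subgroup.mem_carrier)

lemma gen_mult: "x \<in> gen K \<Longrightarrow> y \<in> gen K \<Longrightarrow> x \<otimes> y \<in> gen K"
  by (rule generate.eng)

lemma gen_inv: "K \<subseteq> I \<Longrightarrow> x \<in> gen K \<Longrightarrow> inv x \<in> gen K"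
  by (meson gen_subgroup subgroup.m_inv_closed)

lemma gen_mono: "K \<subseteq> L \<Longrightarrow> x \<in> gen K \<Longrightarrow> x \<in> gen L"
  using mono_generate[of K L] by auto

section \<open>The reflections attached to a word and the parity of their multiplicities\<close>

lemma reflections_closed: "xs \<in> lists I \<Longrightarrow> t \<in> set (reflections W xs) \<Longrightarrow> t \<in> carrier W"
  by (induction xs arbitrary: t) auto

lemma reflections_append:
  assumes "xs \<in> lists I" "ys \<in> lists I"
  shows "reflections W (xs @ ys) =
    reflections W xs @ map (\<lambda>t. val xs \<otimes> t \<otimes> inv (val xs)) (reflections W ys)"
  using assms
proof (induction xs)
  case Nil
  have "map (\<lambda>t. \<one> \<otimes> t \<otimes> inv \<one>) (reflections W ys) = reflections W ys"
    using reflections_closed[OF assms(2)] by (intro map_idI) auto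
  thus ?case by simp
next
  case (Cons s xs)
  thus ?case using reflections_closed[OF assms(2)]
    by (auto simp: inv_mult_group m_assoc)
qed

text \<open>Two letters s, t put in front contribute s and sts, the values at exponents 0 and 1, and
  conjugate the remaining entries by st, which raises each exponent by 2.\<close>

lemma reflections_relator:
  assumes "s \<in> I" "t \<in> I"
  shows "reflections W (concat (replicate n [s, t])) =
    map (\<lambda>i. (s \<otimes> t) [^] i \<otimes> s) [0..<2 * n]"
proof (induction n)
  case (Suc n)
  let ?f = "\<lambda>i. (s \<otimes> t) [^] (i::nat) \<otimes> s"
  have *: "s \<otimes> (t \<otimes> ?f i \<otimes> t) \<otimes> s = ?f (i + 2)" for i
  proof -
    have "s \<otimes> (t \<otimes> ?f i \<otimes> t) \<otimes> s = (s \<otimes> t) \<otimes> (s \<otimes> t) [^] i \<otimes> (s \<otimes> t) \<otimes> s"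
      using assms by (simp add: m_assoc)
    also have "(s \<otimes> t) \<otimes> (s \<otimes> t) [^] i = (s \<otimes> t) [^] i \<otimes> (s \<otimes> t)"
      using assms by (metis I_closed m_closed nat_pow_Suc nat_pow_Suc2)
    finally show ?thesis using assms by simp
  qed
  have u: "[0..<2 * Suc n] = 0 # 1 # map (\<lambda>i. i + 2) [0..<2 * n]"
    by (rule nth_equalityI) (auto simp: nth_Cons nth_append less_Suc_eq split: nat.splits simp del: upt_Suc)
  show ?case unfolding u using assms
    by (simp add: Suc.IH * comp_def del: upt_Suc)
qed simp

text \<open>The reflections of the relator \<open>(st)\<^bsup>m\<^esup>\<close> form a list that is the repetition of its first half,
  so inserting a relator does not change the parity of the multiplicity of any reflection.\<close>

lemma even_reflections_relator:
  assumes "s \<in> I" "t \<in> I" "(s \<otimes> t) [^] (n::nat) = \<one>"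
  shows "even (count_list (map f (reflections W (concat (replicate n [s, t])))) r)"
proof -
  let ?f = "\<lambda>i. (s \<otimes> t) [^] (i::nat) \<otimes> s"
  have "[0..<2 * n] = [0..<n] @ map (\<lambda>i. i + n) [0..<n]"
    by (simp add: map_add_upt mult_2 upt_add_eq_append[of 0 n n])
  moreover have "?f (i + n) = ?f i" for i
    using assms by (simp flip: nat_pow_mult)
  ultimately have "map ?f [0..<2 * n] = map ?f [0..<n] @ map ?f [0..<n]"
    by (simp del: upt_Suc)
  thus ?thesis by (simp add: reflections_relator[OF assms(1,2)] del: upt_Suc)
qed

lemma word_value_relator:
  "s \<in> I \<Longrightarrow> t \<in> I \<Longrightarrow> val (concat (replicate n [s, t])) = (s \<otimes> t) [^] n"
proof (induction n)
  case (Suc n)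
  hence "val (concat (replicate (Suc n) [s, t])) = s \<otimes> t \<otimes> (s \<otimes> t) [^] n"
    by (simp add: m_assoc)
  thus ?case using Suc.prems nat_pow_Suc2[of "s \<otimes> t" n] by simp
qed simp

text \<open>Words with equal values are connected by insertions and deletions of relators, and an
  inserted relator adds an even number of copies of every reflection. The parity therefore descends
  from words to group elements.\<close>

lemma odd_reflections_cong:
  assumes "xs \<in> lists I" "ys \<in> lists I" "val xs = val ys"
  shows "odd (count_list (reflections W xs) r) \<longleftrightarrow> odd (count_list (reflections W ys) r)"
proof -
  obtain m where m: "coxeter_matrix I m" and
    p: "\<forall>xs\<in>lists I. \<forall>ys\<in>lists I. val xs = val ys \<longleftrightarrow> equivclp (coxeter_move I m) xs ys"
    using presented by auto
  have move: "odd (count_list (reflections W xs) r) \<longleftrightarrow> odd (count_list (reflections W ys) r)"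
    if "coxeter_move I m xs ys" for xs ys
  proof -
    obtain us vs s t where *: "us \<in> lists I" "vs \<in> lists I" "s \<in> I" "t \<in> I" "xs = us @ vs"
      "ys = us @ concat (replicate (m s t) [s, t]) @ vs"
      using \<open>coxeter_move I m xs ys\<close> unfolding coxeter_move_def by (elim bexE conjE)
    let ?rel = "concat (replicate (m s t) [s, t])"
    have rel: "concat (replicate n [s, t]) \<in> lists I" for n using *(3,4) by (induction n) auto
    have "coxeter_move I m [] ?rel"
      unfolding coxeter_move_def using * by (intro bexI[of _ "[]"] bexI[of _ s] bexI[of _ t]) auto
    hence "val [] = val ?rel" using p rel[of "m s t"] by (meson r_into_equivclp lists.Nil)
    hence rel1: "val ?rel = \<one>" by simp
    hence "(s \<otimes> t) [^] m s t = \<one>" using word_value_relator * by simp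
    note ev = even_reflections_relator[OF *(3,4) this]
    \<comment> \<open>The relator has value 1, so it does not conjugate the reflections of the
      letters behind it.\<close>
    have "map (\<lambda>t. \<one> \<otimes> t \<otimes> inv \<one>) (reflections W vs) = reflections W vs"
      using reflections_closed[OF *(2)] by (intro map_idI) auto
    hence "reflections W (?rel @ vs) = reflections W ?rel @ reflections W vs"
      using reflections_append[OF rel[of "m s t"] *(2)] rel1 by simp
    thus ?thesis using * rel ev[of "\<lambda>t. val us \<otimes> t \<otimes> inv (val us)" r]
      by (simp add: reflections_append)
  qed
  have "equivclp (coxeter_move I m) xs ys" using p assms by auto
  thus ?thesis
  proof (induction rule: equivclp_induct)
    case (step y z)
    thus ?case using move[of y z] move[of z y] by (elim disjE) simp_all
  qed simp
qed

text \<open>For some i the reflection \<open>t\<close> is the conjugate of si by s1 ... s(i-1), so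
  multiplying by \<open>t\<close> collapses the prefix s1 ... si to s1 ... s(i-1).\<close>

lemma delete_letter:
  assumes "xs \<in> lists I" "t \<in> set (reflections W xs)"
  shows "\<exists>ys s zs. xs = ys @ s # zs \<and> t \<otimes> val xs = val (ys @ zs)"
  using assms
proof (induction xs arbitrary: t)
  case (Cons s xs)
  show ?case
  proof (cases "t = s")
    case True
    hence "s # xs = [] @ s # xs \<and> t \<otimes> val (s # xs) = val ([] @ xs)" using Cons by auto
    thus ?thesis by blast
  next
    case False
    then obtain t' where t': "t' \<in> set (reflections W xs)" "t = s \<otimes> t' \<otimes> s"
      using Cons by auto
    then obtain ys s' zs where *: "xs = ys @ s' # zs" "t' \<otimes> val xs = val (ys @ zs)"
      using Cons.IH[OF t'(1)] by blast
    have "t' \<in> carrier W" using t' reflections_closed Cons by auto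
    hence "t \<otimes> val (s # xs) = s \<otimes> (t' \<otimes> val xs)"
      using t' Cons.hyps by (simp add: m_assoc)
    hence "s # xs = (s # ys) @ s' # zs \<and> t \<otimes> val (s # xs) = val ((s # ys) @ zs)"
      using * by simp
    thus ?thesis by blast
  qed
qed simp

section \<open>Length and the exchange condition\<close>

lemma length_le_word: "xs \<in> lists I \<Longrightarrow> len (val xs) \<le> length xs"
  unfolding coxeter_length_def by (rule Least_le) auto

lemma reduced_word:
  assumes "w \<in> carrier W"
  obtains xs where "xs \<in> lists I" "val xs = w" "length xs = len w"
proof -
  have "w \<in> val ` lists I" using assms generated gen_eq_words[of I] by auto
  hence "\<exists>n. \<exists>xs\<in>lists I. length xs = n \<and> val xs = w" by auto
  from LeastI_ex[OF this] show ?thesis using that unfolding coxeter_length_def by auto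
qed

lemma length_mult_le:
  assumes "v \<in> carrier W" "w \<in> carrier W" shows "len (v \<otimes> w) \<le> len v + len w"
proof -
  obtain xs ys where "xs \<in> lists I" "val xs = v" "length xs = len v"
    "ys \<in> lists I" "val ys = w" "length ys = len w"
    using assms by (metis reduced_word)
  thus ?thesis using length_le_word[of "xs @ ys"] by (simp add: word_value_append)
qed

lemma length_inv [simp]:
  assumes "w \<in> carrier W" shows "len (inv w) = len w"
proof -
  have "len (inv w) \<le> len w" if "w \<in> carrier W" for w
    using that by (metis reduced_word length_le_word length_rev lists_eq_set mem_Collect_eq set_rev word_value_rev)
  from this[of w] this[of "inv w"] show ?thesis using assms by simp
qed

lemma length_one [simp]: "len \<one> = 0"
  using length_le_word[of "[]"] by simp

lemma length_0_iff: "w \<in> carrier W \<Longrightarrow> len w = 0 \<longleftrightarrow> w = \<one>"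
  using reduced_word[of w] by (metis length_0_conv length_one word_value_Nil)

text \<open>Putting \<open>s\<close> in front of a word conjugates its reflections by
  \<open>s\<close>, which fixes \<open>s\<close>, and adds one copy of \<open>s\<close>. Either
  \<open>s\<close> has odd multiplicity for \<open>xs\<close>, and a letter can be deleted, or it
  has odd multiplicity for a reduced word of the product, and deleting a letter there would make
  \<open>val xs\<close> shorter than the product.\<close>

lemma exchange:
  assumes "s \<in> I" "xs \<in> lists I" "len (s \<otimes> val xs) \<le> len (val xs)"
  shows "\<exists>ys r zs. xs = ys @ r # zs \<and> s \<otimes> val xs = val (ys @ zs)"
proof -
  have conj: "s \<otimes> t \<otimes> s = s \<longleftrightarrow> t = s" if "t \<in> carrier W" for t
  proof
    assume "s \<otimes> t \<otimes> s = s"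
    hence "s \<otimes> (s \<otimes> t \<otimes> s) \<otimes> s = s \<otimes> s \<otimes> s" by simp
    thus "t = s" using that assms(1) by (simp add: m_assoc)
  qed (use assms in simp)
  have "count_list (map (\<lambda>t. s \<otimes> t \<otimes> s) ts) s = count_list ts s" if "set ts \<subseteq> carrier W" for ts
    using that by (induction ts) (auto simp: conj)
  hence flip: "count_list (reflections W (s # ys)) s = Suc (count_list (reflections W ys) s)"
    if "ys \<in> lists I" for ys using that reflections_closed by (simp add: subset_iff)
  have del: "\<exists>ys r zs. xs = ys @ r # zs \<and> s \<otimes> val xs = val (ys @ zs)"
    if "xs \<in> lists I" "odd (count_list (reflections W xs) s)" for xs
    using that delete_letter[of xs s] by (metis count_notin even_zero)
  show ?thesis
  proof (cases "odd (count_list (reflections W xs) s)")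
    case True
    thus ?thesis using del assms by blast
  next
    case False
    obtain ys where ys: "ys \<in> lists I" "val ys = s \<otimes> val xs" "length ys = len (s \<otimes> val xs)"
      using reduced_word[of "s \<otimes> val xs"] assms by auto
    \<comment> \<open>\<open>s # xs\<close> and \<open>ys\<close> have the same value, and the
      former has one copy of \<open>s\<close> more than \<open>xs\<close>.\<close>
    have "odd (count_list (reflections W ys) s)"
      using odd_reflections_cong[of "s # xs" ys s] False flip assms ys by auto
    from del[OF ys(1) this] obtain as r bs
      where *: "ys = as @ r # bs" "s \<otimes> val ys = val (as @ bs)" by auto
    have "len (val xs) \<le> length (as @ bs)"
      using * ys assms length_le_word[of "as @ bs"] by auto
    also have "\<dots> < len (val xs)" using * ys assms by simp
    finally show ?thesis by simp
  qed
qed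

text \<open>Parity separates \<open>s\<close> from the identity: the one-letter word has the single
  reflection \<open>s\<close>, the empty word has none.\<close>

lemma length_generator [simp]:
  assumes "s \<in> I" shows "len s = 1"
proof -
  have "len s \<noteq> 0"
  proof
    assume "len s = 0"
    hence "val [s] = val []" using assms by (simp add: length_0_iff)
    from odd_reflections_cong[OF _ _ this, of s] assms show False by simp
  qed
  thus ?thesis using length_le_word[of "[s]"] assms by simp
qed

section \<open>Minimal coset representatives and additivity of length\<close>

lemma left_reps_iff:
  "w \<in> left_reps K \<longleftrightarrow> w \<in> carrier W \<and> (\<forall>k\<in>gen K. len w \<le> len (k \<otimes> w))"
  by (auto simp: min_reps_left_quotient_def r_coset_def)

text \<open>Inversion preserves length and exchanges left and right cosets; most facts about right
  representatives are reduced to left ones in this way.\<close>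

lemma right_reps_iff_inv:
  assumes "K \<subseteq> I"
  shows "w \<in> right_reps K \<longleftrightarrow> w \<in> carrier W \<and> inv w \<in> left_reps K"
proof -
  have *: "len (k \<otimes> inv w) = len (w \<otimes> inv k)" if "k \<in> gen K" "w \<in> carrier W" for k
    using that assms gen_closed length_inv[of "w \<otimes> inv k"] by (simp add: inv_mult_group)
  have "(\<forall>k\<in>gen K. len w \<le> len (w \<otimes> k)) \<longleftrightarrow> (\<forall>k\<in>gen K. len w \<le> len (w \<otimes> inv k))"
    using gen_inv[OF assms] gen_closed[OF assms] by (metis inv_inv)
  thus ?thesis
    by (auto simp: min_reps_right_quotient_def l_coset_def left_reps_iff *)
qed

lemma left_reps_closed: "w \<in> left_reps K \<Longrightarrow> w \<in> carrier W"
  by (simp add: left_reps_iff)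

lemma right_reps_closed: "w \<in> right_reps K \<Longrightarrow> w \<in> carrier W"
  by (simp add: min_reps_right_quotient_def)

lemma one_left_reps: "\<one> \<in> left_reps K"
  by (simp add: left_reps_iff)

text \<open>The word is only assumed shortest among words over \<open>K\<close>. If prefixing
  \<open>s\<close> failed to lengthen the product, the exchange condition would delete a letter
  either of the word, against its minimality, or of \<open>m\<close>, against the minimality of
  \<open>m\<close> in its coset.\<close>

lemma length_parabolic_word_mult:
  assumes "K \<subseteq> I" "m \<in> left_reps K" "xs \<in> lists K"
    and "\<And>ys. ys \<in> lists K \<Longrightarrow> val ys = val xs \<Longrightarrow> length xs \<le> length ys"
  shows "len (val xs \<otimes> m) = length xs + len m"
  using assms(3,4)
proof (induction xs)
  case Nil
  thus ?case using assms by (simp add: left_reps_closed)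
next
  case (Cons s xs)
  have m: "m \<in> carrier W" using assms left_reps_closed by blast
  have sK: "s \<in> K" "s \<in> I" and xsK: "xs \<in> lists K" and xsI: "xs \<in> lists I"
    using Cons.hyps assms(1) by auto
  note c = word_value_closed[OF xsI]
  have IH: "len (val xs \<otimes> m) = length xs + len m"
  proof (rule Cons.IH)
    fix ys assume "ys \<in> lists K" "val ys = val xs"
    thus "length xs \<le> length ys" using Cons.prems[of "s # ys"] sK by simp
  qed
  obtain ms where ms: "ms \<in> lists I" "val ms = m" "length ms = len m"
    using m reduced_word by blast
  have "\<not> len (s \<otimes> val (xs @ ms)) \<le> len (val (xs @ ms))"
  proof
    assume "len (s \<otimes> val (xs @ ms)) \<le> len (val (xs @ ms))"
    from exchange[OF sK(2) _ this] xsI ms obtain as r bs where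
      del: "xs @ ms = as @ r # bs" and eq: "s \<otimes> val (xs @ ms) = val (as @ bs)" by auto
    have eq': "s \<otimes> (val xs \<otimes> m) = val (as @ bs)"
      using eq ms xsI by (simp add: word_value_append)
    consider (l) cs where "xs = as @ r # cs" "bs = cs @ ms"
      | (r) cs where "as = xs @ cs" "ms = cs @ r # bs"
      using del by (auto simp: append_eq_append_conv2 append_eq_Cons_conv)
    thus False
    proof cases
      case l
      have "s \<otimes> val xs \<otimes> m = val (as @ cs) \<otimes> m"
        using eq' l ms xsI sK m c by (simp add: word_value_append m_assoc)
      moreover have "val (as @ cs) \<in> carrier W" "s \<otimes> val xs \<in> carrier W"
        using l xsI sK by auto
      ultimately have "val (as @ cs) = val (s # xs)" using m by simp
      from Cons.prems[OF _ this] xsK l show False by simp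
    next
      case r
      have cb: "cs \<in> lists I" "bs \<in> lists I" using r ms by auto
      hence "s \<otimes> val xs \<otimes> m = val xs \<otimes> val (cs @ bs)"
        using eq' r xsI sK m c by (simp add: word_value_append m_assoc)
      hence "s \<otimes> (val xs \<otimes> m) = val xs \<otimes> val (cs @ bs)" using c sK m by (simp add: m_assoc)
      \<comment> \<open>The deleted letter belongs to \<open>m\<close>: moving the other factors,
        all in W_K, to the left exhibits an element of the coset of \<open>m\<close> that is shorter
        than \<open>m\<close>.\<close>
      hence "inv (val xs) \<otimes> (s \<otimes> val xs) \<otimes> m = val (cs @ bs)"
        using c sK m cb by (simp add: m_assoc)
      moreover have "inv (val xs) \<otimes> (s \<otimes> val xs) \<in> gen K"
        using xsK sK assms(1) gen_eq_words[OF assms(1)] by (intro gen_mult gen_inv) (auto intro: generate.incl)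
      ultimately have "len m \<le> len (val (cs @ bs))"
        using assms(2) unfolding left_reps_iff by metis
      also have "\<dots> < len m" using length_le_word[of "cs @ bs"] cb r ms by auto
      finally show False by simp
    qed
  qed
  hence "len (val (s # xs) \<otimes> m) > length xs + len m"
    using IH xsI ms m sK c by (simp add: word_value_append m_assoc)
  moreover have "len (val (s # xs) \<otimes> m) \<le> Suc (length xs + len m)"
    using length_mult_le[of s "val xs \<otimes> m"] IH m sK c by (simp add: m_assoc)
  ultimately show ?case by simp
qed

lemma parabolic_reduced_word:
  assumes "K \<subseteq> I" "k \<in> gen K"
  obtains xs where "xs \<in> lists K" "val xs = k" "length xs = len k"
    "\<And>m. m \<in> left_reps K \<Longrightarrow> len (k \<otimes> m) = len k + len m"
proof -
  have "\<exists>xs. xs \<in> lists K \<and> val xs = k" using gen_eq_words assms by auto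
  then obtain xs where xs: "xs \<in> lists K" "val xs = k"
    and min: "\<And>ys. ys \<in> lists K \<and> val ys = k \<Longrightarrow> length xs \<le> length ys"
    using ex_has_least_nat[of "\<lambda>xs. xs \<in> lists K \<and> val xs = k" _ length] by blast
  have *: "len (k \<otimes> m) = length xs + len m" if "m \<in> left_reps K" for m
    using length_parabolic_word_mult[OF assms(1) that xs(1)] min xs(2) by auto
  \<comment> \<open>The case m = 1 identifies the length over the alphabet \<open>K\<close> with the
    length in the whole group.\<close>
  have "length xs = len k"
    using *[OF one_left_reps] assms gen_closed by simp
  with xs * that show ?thesis by metis
qed

lemma length_left_reps_mult:
  "K \<subseteq> I \<Longrightarrow> k \<in> gen K \<Longrightarrow> m \<in> left_reps K \<Longrightarrow> len (k \<otimes> m) = len k + len m"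
  by (metis parabolic_reduced_word)

lemma length_right_reps_mult:
  assumes "K \<subseteq> I" "k \<in> gen K" "m \<in> right_reps K"
  shows "len (m \<otimes> k) = len m + len k"
  using length_left_reps_mult[of K "inv k" "inv m"] assms gen_inv[of K k] gen_closed[of K k]
    length_inv[of "m \<otimes> k"]
  by (simp add: right_reps_iff_inv inv_mult_group del: length_inv) (simp add: )

lemma parabolic_Int_generators:
  assumes "K \<subseteq> I" "s \<in> I" "s \<in> gen K" shows "s \<in> K"
proof -
  obtain xs where "xs \<in> lists K" "val xs = s" "length xs = 1"
    using parabolic_reduced_word[OF assms(1,3)] assms(2) by (metis length_generator)
  thus ?thesis using assms by (cases xs) auto
qed

lemma left_reps_decomp:
  assumes "K \<subseteq> I" "x \<in> carrier W"
  obtains k m where "k \<in> gen K" "m \<in> left_reps K" "x = k \<otimes> m"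
proof -
  obtain k where k: "k \<in> gen K" and min: "\<And>j. j \<in> gen K \<Longrightarrow> len (k \<otimes> x) \<le> len (j \<otimes> x)"
    using ex_has_least_nat[of "\<lambda>k. k \<in> gen K" \<one> "\<lambda>k. len (k \<otimes> x)"] generate.one by metis
  have kc: "k \<in> carrier W" using k gen_closed assms by blast
  have "len (k \<otimes> x) \<le> len (j \<otimes> (k \<otimes> x))" if "j \<in> gen K" for j
    using min[OF gen_mult[OF that k]] that assms gen_closed kc by (simp add: m_assoc)
  hence "k \<otimes> x \<in> left_reps K" using kc assms by (simp add: left_reps_iff)
  moreover have "x = inv k \<otimes> (k \<otimes> x)" using kc assms by (simp add: m_assoc[symmetric])
  ultimately show ?thesis using that gen_inv[OF assms(1) k] by blast
qed

text \<open>Lengths add in the product of \<open>k\<close> and \<open>m'\<close>, while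
  \<open>m\<close> is no longer than \<open>m'\<close>, so \<open>k\<close> has length 0.\<close>

lemma left_reps_unique:
  assumes "K \<subseteq> I" "m \<in> left_reps K" "m' \<in> left_reps K" "k \<in> gen K" "m = k \<otimes> m'"
  shows "m = m'" "k = \<one>"
proof -
  have c: "m \<in> carrier W" "m' \<in> carrier W" "k \<in> carrier W"
    using assms left_reps_closed gen_closed by blast+
  have "len m = len k + len m'" using length_left_reps_mult assms by simp
  moreover have "inv k \<otimes> m = m'" using assms(5) c by (simp add: m_assoc[symmetric])
  hence "len m \<le> len m'" using assms(2) gen_inv[OF assms(1,4)] unfolding left_reps_iff by metis
  ultimately show "k = \<one>" using length_0_iff c by simp
  thus "m = m'" using assms c by simp
qed

text \<open>If the factor of \<open>w\<close> in W_K is nontrivial, the first letter of a reduced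
  word for it over \<open>K\<close> already shortens \<open>w\<close>. Minimality can thus be tested
  on generators.\<close>

lemma left_repsI:
  assumes "K \<subseteq> I" "w \<in> carrier W" "\<And>s. s \<in> K \<Longrightarrow> len w \<le> len (s \<otimes> w)"
  shows "w \<in> left_reps K"
proof -
  obtain k m where km: "k \<in> gen K" "m \<in> left_reps K" "w = k \<otimes> m"
    using left_reps_decomp[OF assms(1,2)] by blast
  obtain xs where xs: "xs \<in> lists K" "val xs = k" "length xs = len k"
    using parabolic_reduced_word[OF assms(1) km(1)] by metis
  have xsI: "xs \<in> lists I" and m: "m \<in> carrier W" using xs assms km left_reps_closed by auto
  show ?thesis
  proof (cases xs)
    case Nil
    hence "w = m" using xs(2)[symmetric] km(3) m by simp
    thus ?thesis using km by simp
  next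
    case (Cons s ys)
    hence s: "s \<in> K" "s \<in> I" "ys \<in> lists I" using xs xsI assms by auto
    have "s \<otimes> w = val ys \<otimes> m" using Cons km(3) xs(2)[symmetric] s m by (simp add: m_assoc)
    hence "len (s \<otimes> w) \<le> length ys + len m"
      using length_mult_le[of "val ys" m] length_le_word[of ys] s m by simp
    also have "\<dots> < len w"
      using length_left_reps_mult[OF assms(1) km(1,2)] km xs Cons by simp
    finally show ?thesis using assms(3)[OF s(1)] by simp
  qed
qed

text \<open>By additivity of length only the trivial multiple of \<open>m\<close> attains the
  minimum, so the \<open>THE\<close> in \<open>coset_min\<close> denotes a unique element.\<close>

lemma coset_min_left:
  assumes "K \<subseteq> I" "m \<in> left_reps K" "k \<in> gen K"
  shows "coset_min W I (gen K #> (k \<otimes> m)) = m"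
proof -
  let ?C = "gen K #> (k \<otimes> m)"
  have c: "m \<in> carrier W" "k \<in> carrier W"
    using assms left_reps_closed gen_closed by blast+
  have C: "?C = gen K #> m"
    using coset_mult_assoc[of "gen K" k m] subgroup.rcos_const[OF gen_subgroup[OF assms(1)] is_group assms(3)]
      c subgroup.subset[OF gen_subgroup[OF assms(1)]] by simp
  have "\<one> \<otimes> m \<in> gen K #> m" unfolding r_coset_def using generate.one by blast
  hence m: "m \<in> ?C" using c unfolding C by simp
  have min: "len m \<le> len y" if "y \<in> ?C" for y
    using that[unfolded C] assms(2) unfolding r_coset_def left_reps_iff by blast
  show ?thesis unfolding coset_min_def
  proof (rule the_equality)
    fix x assume x: "x \<in> ?C \<and> (\<forall>y\<in>?C. len x \<le> len y)"
    hence "x \<in> gen K #> m" unfolding C by simp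
    then obtain j where j: "j \<in> gen K" "x = j \<otimes> m" unfolding r_coset_def by blast
    have "len j + len m = len x"
      using length_left_reps_mult[OF assms(1) j(1) assms(2)] j(2) by simp
    moreover have "len x \<le> len m" using x m by blast
    ultimately have "len j = 0" by simp
    hence "j = \<one>" using length_0_iff j gen_closed[OF assms(1)] by simp
    thus "x = m" using j c by simp
  qed (use m min in blast)
qed

lemma right_reps_decomp:
  assumes "K \<subseteq> I" "x \<in> carrier W"
  obtains k m where "k \<in> gen K" "m \<in> right_reps K" "x = m \<otimes> k"
proof -
  obtain k m where *: "k \<in> gen K" "m \<in> left_reps K" "inv x = k \<otimes> m"
    using left_reps_decomp[of K "inv x"] assms by auto
  have c: "k \<in> carrier W" "m \<in> carrier W" using * assms gen_closed left_reps_closed by blast+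
  have "x = inv m \<otimes> inv k" using *(3) c assms by (metis inv_inv inv_mult_group)
  moreover have "inv m \<in> right_reps K" using * c assms by (simp add: right_reps_iff_inv)
  ultimately show ?thesis using that gen_inv[OF assms(1) *(1)] by blast
qed

lemma right_reps_unique:
  assumes "K \<subseteq> I" "m \<in> right_reps K" "m' \<in> right_reps K" "k \<in> gen K" "m = m' \<otimes> k"
  shows "m = m'"
proof -
  have c: "m \<in> carrier W" "m' \<in> carrier W" "k \<in> carrier W"
    using assms right_reps_closed gen_closed by blast+
  have "inv m = inv m'"
    using left_reps_unique(1)[OF assms(1), of "inv m" "inv m'" "inv k"] assms c
    by (simp add: right_reps_iff_inv gen_inv inv_mult_group)
  thus ?thesis using c by (metis inv_inv)
qed

lemma coset_min_right:
  assumes "K \<subseteq> I" "m \<in> right_reps K" "k \<in> gen K"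
  shows "coset_min W I ((m \<otimes> k) <# gen K) = m"
proof -
  let ?C = "(m \<otimes> k) <# gen K"
  have c: "m \<in> carrier W" "k \<in> carrier W"
    using assms right_reps_closed gen_closed by blast+
  have C: "?C = m <# gen K"
  proof -
    have "k <# gen K = gen K"
      using coset_join3[OF c(2) gen_subgroup[OF assms(1)] assms(3)] .
    thus ?thesis using c subgroup.subset[OF gen_subgroup[OF assms(1)]] lcos_m_assoc[of "gen K" m k]
      by simp
  qed
  have "m \<otimes> \<one> \<in> m <# gen K" unfolding l_coset_def using generate.one by blast
  hence m: "m \<in> ?C" using c unfolding C by simp
  have min: "len m \<le> len y" if "y \<in> ?C" for y
    using that[unfolded C] assms(2) unfolding min_reps_right_quotient_def by blast
  show ?thesis unfolding coset_min_def
  proof (rule the_equality)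
    fix x assume x: "x \<in> ?C \<and> (\<forall>y\<in>?C. len x \<le> len y)"
    hence "x \<in> m <# gen K" by (simp add: C)
    then obtain j where j: "j \<in> gen K" "x = m \<otimes> j" unfolding l_coset_def by auto
    have "len m + len j = len x"
      using length_right_reps_mult[OF assms(1) j(1) assms(2)] j(2) by simp
    moreover have "len x \<le> len m" using x m by blast
    ultimately have "len j = 0" by simp
    hence "j = \<one>" using length_0_iff j gen_closed[OF assms(1)] by simp
    thus "x = m" using j c by simp
  qed (use m min in blast)
qed

text \<open>Lengths add in the product, so a generator that shortened \<open>m\<close> would shorten
  the product as well. This is what makes the element \<open>w1\<close> of a stage minimal from both
  sides.\<close>

lemma left_reps_of_mult:
  assumes "K \<subseteq> I" "J \<subseteq> I" "m \<in> right_reps J" "k \<in> gen J" "m \<otimes> k \<in> left_reps K"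
  shows "m \<in> left_reps K"
proof (rule left_repsI[OF assms(1)])
  have c: "m \<in> carrier W" "k \<in> carrier W"
    using assms right_reps_closed gen_closed by blast+
  show "m \<in> carrier W" by fact
  fix s assume s: "s \<in> K"
  hence sc: "s \<in> carrier W" using assms by auto
  have "len m + len k \<le> len (s \<otimes> (m \<otimes> k))"
    using length_right_reps_mult[OF assms(2,4,3)] assms(5) s
    unfolding left_reps_iff by (metis generate.incl)
  also have "\<dots> \<le> len (s \<otimes> m) + len k"
    using length_mult_le[of "s \<otimes> m" k] sc c by (simp add: m_assoc)
  finally show "len m \<le> len (s \<otimes> m)" by simp
qed

lemma right_reps_of_mult:
  assumes "K \<subseteq> I" "J \<subseteq> I" "m \<in> left_reps K" "k \<in> gen K" "k \<otimes> m \<in> right_reps J"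
  shows "m \<in> right_reps J"
proof -
  have c: "m \<in> carrier W" "k \<in> carrier W"
    using assms left_reps_closed gen_closed by blast+
  show ?thesis
    using left_reps_of_mult[OF assms(2,1), of "inv m" "inv k"] assms c
    by (simp add: right_reps_iff_inv gen_inv inv_mult_group)
qed

section \<open>Double coset representatives and intersections of conjugate parabolic
  subgroups\<close>

lemma conj_gen:
  assumes "K \<subseteq> carrier W" "w \<in> carrier W" "k \<in> gen K"
  shows "w \<otimes> k \<otimes> inv w \<in> gen (conj_set W w K)"
  using assms(3)
proof induction
  case one thus ?case using assms by (simp add: generate.one)
next
  case (incl h) thus ?case by (auto simp: conj_set_def intro!: generate.incl)
next
  case (inv h)
  hence "inv (w \<otimes> h \<otimes> inv w) \<in> gen (conj_set W w K)"
    by (intro generate.inv) (auto simp: conj_set_def)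
  moreover have "h \<in> carrier W" using inv assms by auto
  ultimately show ?case using assms by (simp add: inv_mult_group m_assoc)
next
  case (eng g h)
  have "g \<in> carrier W" "h \<in> carrier W" using eng.hyps assms generate_in_carrier by blast+
  hence "w \<otimes> (g \<otimes> h) \<otimes> inv w = (w \<otimes> g \<otimes> inv w) \<otimes> (w \<otimes> h \<otimes> inv w)"
    using assms by (simp add: m_assoc)
  thus ?case using eng.IH by (simp add: generate.eng)
qed

text \<open>Suppose \<open>s\<close> in \<open>K\<close> shortens the product. By exchange a letter
  of \<open>d\<close> or of \<open>t\<close> is deleted. The former contradicts the minimality of
  \<open>d\<close>; the latter yields a simple reflection r in \<open>J\<close> with s d = d r that
  shortens \<open>t\<close>, although r lies in the set for which \<open>t\<close> is
  minimal.\<close>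

lemma left_reps_mult:
  assumes KJ: "K \<subseteq> I" "J \<subseteq> I" and d: "d \<in> left_reps K" "d \<in> right_reps J"
    and t: "t \<in> gen J" "t \<in> left_reps {r \<in> J. d \<otimes> r \<otimes> inv d \<in> K}"
  shows "d \<otimes> t \<in> left_reps K"
proof (rule left_repsI[OF KJ(1)])
  have dc: "d \<in> carrier W" and tc: "t \<in> carrier W"
    using d t KJ left_reps_closed gen_closed by blast+
  show "d \<otimes> t \<in> carrier W" using dc tc by simp
  fix s assume s: "s \<in> K"
  hence sI: "s \<in> I" using KJ by auto
  obtain ds where ds: "ds \<in> lists I" "val ds = d" "length ds = len d"
    using dc reduced_word by blast
  obtain ts where ts: "ts \<in> lists J" "val ts = t" "length ts = len t"
    using parabolic_reduced_word[OF KJ(2) t(1)] by metis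
  hence tsI: "ts \<in> lists I" using KJ by auto
  show "len (d \<otimes> t) \<le> len (s \<otimes> (d \<otimes> t))"
  proof (rule ccontr)
    assume "\<not> ?thesis"
    hence "len (s \<otimes> val (ds @ ts)) \<le> len (val (ds @ ts))"
      using ds ts tsI by (simp add: word_value_append)
    from exchange[OF sI _ this] ds tsI obtain as r bs where
      del: "ds @ ts = as @ r # bs" and "s \<otimes> val (ds @ ts) = val (as @ bs)" by auto
    from this(2) have eq: "s \<otimes> (d \<otimes> t) = val (as @ bs)"
      using ds ts tsI by (simp add: word_value_append)
    consider (l) cs where "ds = as @ r # cs" "bs = cs @ ts"
      | (r) cs where "as = ds @ cs" "ts = cs @ r # bs"
      using del by (auto simp: append_eq_append_conv2 append_eq_Cons_conv)
    thus False
    proof cases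
      case l
      have ac: "as \<in> lists I" "cs \<in> lists I" using l ds by auto
      hence "s \<otimes> d \<otimes> t = val (as @ cs) \<otimes> t"
        using eq l tsI ts sI dc tc by (simp add: word_value_append m_assoc)
      hence "s \<otimes> d = val (as @ cs)" using sI dc tc ac by (simp add: word_value_append)
      hence "len (s \<otimes> d) < len d" using length_le_word[of "as @ cs"] ac l ds by auto
      moreover have "len d \<le> len (s \<otimes> d)"
        using d(1) s unfolding left_reps_iff by (metis generate.incl)
      ultimately show False by simp
    next
      case r
      have cb: "cs \<in> lists I" "bs \<in> lists I" "cs @ bs \<in> lists J" using r tsI ts by auto
      let ?t' = "val (cs @ bs)" let ?r = "?t' \<otimes> inv t"
      have t': "?t' \<in> gen J" using cb gen_eq_words[OF KJ(2)] by auto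
      have t'c: "?t' \<in> carrier W" using cb by auto
      have rJ: "?r \<in> gen J" using t' t KJ by (intro gen_mult gen_inv) auto
      have "s \<otimes> (d \<otimes> t) = d \<otimes> ?t'" using eq r ds cb dc by (simp add: word_value_append)
      hence "s \<otimes> d \<otimes> t = d \<otimes> ?t'" using sI dc tc by (simp add: m_assoc)
      hence sd: "s \<otimes> d = d \<otimes> ?r" 
      proof -
        have "s \<otimes> d = (s \<otimes> d \<otimes> t) \<otimes> inv t" using sI dc tc by (simp add: m_assoc)
        thus ?thesis using \<open>s \<otimes> d \<otimes> t = d \<otimes> ?t'\<close> dc tc t'c by (simp add: m_assoc)
      qed
      hence s_conj: "d \<otimes> ?r \<otimes> inv d = s" using sI dc
        by (metis I_closed r_inv m_assoc r_one inv_closed)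
      \<comment> \<open>The length of s d = d r, computed in both ways, bounds the length of
        \<open>?r\<close> by 1; being nontrivial, it is a simple reflection of
        \<open>J\<close>.\<close>
      have "len d + len ?r = len (s \<otimes> d)"
        using length_right_reps_mult[OF KJ(2) rJ d(2)] sd by simp
      also have "\<dots> \<le> 1 + len d" using length_mult_le[of s d] sI dc by simp
      finally have "len ?r \<le> 1" by simp
      moreover have "?r \<noteq> \<one>"
      proof
        assume "?r = \<one>"
        hence "s = \<one>" using s_conj dc by simp
        thus False using length_generator[OF sI] by simp
      qed
      ultimately have "len ?r = 1" using length_0_iff[of ?r] tc t'c by (simp add: le_Suc_eq)
      moreover obtain rs where "rs \<in> lists J" "val rs = ?r" "length rs = len ?r"
        using parabolic_reduced_word[OF KJ(2) rJ] by metis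
      ultimately have "?r \<in> J" using KJ by (auto simp: length_Suc_conv)
      hence "len t \<le> len (?r \<otimes> t)"
        using t(2) s_conj s unfolding left_reps_iff by (metis (mono_tags, lifting) generate.incl mem_Collect_eq)
      also have "?r \<otimes> t = ?t'" using tc t'c by (simp add: m_assoc)
      also have "len ?t' < len t" using length_le_word[of "cs @ bs"] cb r ts by auto
      finally show False by simp
    qed
  qed
qed

text \<open>Split t = a b with a in the parabolic subgroup of those r in \<open>J\<close> for which
  d r d^-1 lies in \<open>K\<close>, and b minimal for it. Then d t is the product of d a d^-1,
  which lies in W_K, and d b, which is minimal, so uniqueness of the factorisation identifies
  \<open>k\<close> and \<open>m\<close>. This controls the effect of one half of a stage.\<close>

lemma left_factor_parabolic:
  assumes KJ: "K \<subseteq> I" "J \<subseteq> I" and d: "d \<in> left_reps K" "d \<in> right_reps J"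
    and t: "t \<in> gen J" and k: "k \<in> gen K" "m \<in> left_reps K" "d \<otimes> t = k \<otimes> m"
  shows "k \<in> gen (conj_set W d J \<inter> K)" "\<exists>t'\<in>gen J. m = d \<otimes> t'"
proof -
  let ?M = "{r \<in> J. d \<otimes> r \<otimes> inv d \<in> K}"
  have M: "?M \<subseteq> I" "?M \<subseteq> J" using KJ by auto
  have c: "d \<in> carrier W" "t \<in> carrier W" "k \<in> carrier W" "m \<in> carrier W"
    using d t k KJ left_reps_closed gen_closed by blast+
  obtain a b where ab: "a \<in> gen ?M" "b \<in> left_reps ?M" "t = a \<otimes> b"
    using left_reps_decomp[OF M(1) c(2)] by blast
  have abc: "a \<in> carrier W" "b \<in> carrier W" using ab M gen_closed left_reps_closed by blast+
  have aJ: "a \<in> gen J" using ab M gen_mono by blast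
  have b: "b = inv a \<otimes> t" using ab abc by (simp add: m_assoc[symmetric])
  have bJ: "b \<in> gen J" unfolding b using aJ t KJ by (intro gen_mult gen_inv)
  have db: "d \<otimes> b \<in> left_reps K" using left_reps_mult[OF KJ d bJ ab(2)] .
  let ?a = "d \<otimes> a \<otimes> inv d"
  have "?a \<in> gen (conj_set W d ?M)" using conj_gen M c ab generators_closed by blast
  moreover have "conj_set W d ?M \<subseteq> conj_set W d J \<inter> K" by (auto simp: conj_set_def)
  ultimately have a': "?a \<in> gen (conj_set W d J \<inter> K)" using gen_mono by blast
  hence aK: "?a \<in> gen K" using gen_mono[of "conj_set W d J \<inter> K" K] by blast
  have eq: "k \<otimes> m = ?a \<otimes> (d \<otimes> b)"
    using k(3) ab(3) c abc by (simp add: m_assoc[symmetric]) (simp add: m_assoc)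
  have "m = (inv k \<otimes> ?a) \<otimes> (d \<otimes> b)"
  proof -
    have "(inv k \<otimes> ?a) \<otimes> (d \<otimes> b) = inv k \<otimes> (?a \<otimes> (d \<otimes> b))"
      using c abc by (intro m_assoc) auto
    also have "\<dots> = m" unfolding eq[symmetric] using c by simp
    finally show ?thesis by simp
  qed
  moreover have "inv k \<otimes> ?a \<in> gen K" using aK gen_inv[OF KJ(1) k(1)] gen_mult by blast
  ultimately have *: "m = d \<otimes> b" "inv k \<otimes> ?a = \<one>"
    using left_reps_unique[OF KJ(1) k(2) db] by blast+
  hence "k \<otimes> (inv k \<otimes> ?a) = k" using c by simp
  moreover have "k \<otimes> (inv k \<otimes> ?a) = ?a" using c abc by (intro inv_cancel_left) auto
  ultimately have "k = ?a" by simp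
  thus "k \<in> gen (conj_set W d J \<inter> K)" using a' by simp
  show "\<exists>t'\<in>gen J. m = d \<otimes> t'" using * bJ by auto
qed

text \<open>The case m = d of the factorisation: here \<open>k\<close> is an arbitrary element
  common to W_K and d W_J d^-1.\<close>

lemma parabolic_conj_Int:
  assumes KJ: "K \<subseteq> I" "J \<subseteq> I" and d: "d \<in> left_reps K" "d \<in> right_reps J"
    and "t \<in> gen J" "k \<in> gen K" "d \<otimes> t = k \<otimes> d"
  shows "k \<in> gen (conj_set W d J \<inter> K)"
  using left_factor_parabolic(1)[OF KJ d assms(5,6) d(1) assms(7)] .

lemma right_factor_parabolic:
  assumes KJ: "K \<subseteq> I" "J \<subseteq> I" and d: "d \<in> left_reps K" "d \<in> right_reps J"
    and t: "t \<in> gen K" and k: "k \<in> gen J" "m \<in> right_reps J" "t \<otimes> d = m \<otimes> k"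
  shows "k \<in> gen (conj_set W (inv d) K \<inter> J)" "\<exists>t'\<in>gen K. m = t' \<otimes> d"
proof -
  have c: "d \<in> carrier W" "t \<in> carrier W" "k \<in> carrier W" "m \<in> carrier W"
    using d t k KJ left_reps_closed right_reps_closed gen_closed by blast+
  have reps: "inv d \<in> left_reps J" "inv d \<in> right_reps K" "inv m \<in> left_reps J"
    using d k c KJ by (simp_all add: right_reps_iff_inv)
  have "inv d \<otimes> inv t = inv k \<otimes> inv m" using k(3) c by (metis inv_mult_group)
  note * = left_factor_parabolic[OF KJ(2,1) reps(1,2) gen_inv[OF KJ(1) t] gen_inv[OF KJ(2) k(1)] reps(3) this]
  have "conj_set W (inv d) K \<inter> J \<subseteq> I" using KJ by auto
  from gen_inv[OF this *(1)] show "k \<in> gen (conj_set W (inv d) K \<inter> J)" using c by simp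
  from *(2) obtain t' where t': "t' \<in> gen K" "inv m = inv d \<otimes> t'" by auto
  have "t' \<in> carrier W" using t' gen_closed KJ by blast
  hence "m = inv t' \<otimes> d" using t'(2) c by (metis inv_inv inv_closed inv_mult_group)
  thus "\<exists>t'\<in>gen K. m = t' \<otimes> d" using gen_inv[OF KJ(1) t'(1)] by auto
qed

text \<open>A reflection of \<open>K\<close> obtained by conjugating with d t lies in both W_K and d
  W_J d^-1, hence in a parabolic subgroup, and a simple reflection in a parabolic subgroup is one of
  its generators. The sets of the recursion shrink for this reason.\<close>

lemma conj_set_Int_mono:
  assumes KJ: "K \<subseteq> I" "J \<subseteq> I" and d: "d \<in> left_reps K" "d \<in> right_reps J"
    and t: "t \<in> gen J" and J': "J' \<subseteq> J"
  shows "conj_set W (d \<otimes> t) J' \<inter> K \<subseteq> conj_set W d J \<inter> K"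
proof
  fix k assume "k \<in> conj_set W (d \<otimes> t) J' \<inter> K"
  then obtain s where s: "s \<in> J'" "k = d \<otimes> t \<otimes> s \<otimes> inv (d \<otimes> t)" and k: "k \<in> K"
    by (auto simp: conj_set_def)
  have c: "d \<in> carrier W" "t \<in> carrier W" "s \<in> carrier W"
    using d t s J' KJ left_reps_closed gen_closed by blast+
  have "t \<otimes> s \<otimes> inv t \<in> gen J"
    using s J' t KJ by (intro gen_mult gen_inv) (auto intro: generate.incl)
  moreover have "d \<otimes> (t \<otimes> s \<otimes> inv t) = k \<otimes> d" using s c by (simp add: m_assoc inv_mult_group)
  ultimately have "k \<in> gen (conj_set W d J \<inter> K)"
    using parabolic_conj_Int[OF KJ d] k generate.incl by metis
  thus "k \<in> conj_set W d J \<inter> K" using parabolic_Int_generators[of "conj_set W d J \<inter> K" k] k KJ by blast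
qed

lemma conj_set_inv_Int_mono:
  assumes KJ: "K \<subseteq> I" "J \<subseteq> I" and d: "d \<in> left_reps K" "d \<in> right_reps J"
    and t: "t \<in> gen K" and K': "K' \<subseteq> K"
  shows "conj_set W (inv (t \<otimes> d)) K' \<inter> J \<subseteq> conj_set W (inv d) K \<inter> J"
proof -
  have c: "d \<in> carrier W" "t \<in> carrier W"
    using d t KJ left_reps_closed gen_closed by blast+
  show ?thesis
    using conj_set_Int_mono[OF KJ(2,1) _ _ gen_inv[OF KJ(1) t] K', of "inv d"] d c KJ
    by (simp add: right_reps_iff_inv inv_mult_group)
qed

lemma conj_set_inv_conj_set:
  assumes "K \<subseteq> carrier W" "w \<in> carrier W"
  shows "conj_set W (inv w) (conj_set W w K) = K" "conj_set W w (conj_set W (inv w) K) = K"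
proof -
  have "inv w \<otimes> (w \<otimes> k \<otimes> inv w) \<otimes> inv (inv w) = k" "w \<otimes> (inv w \<otimes> k \<otimes> inv (inv w)) \<otimes> inv w = k"
    if "k \<in> K" for k using that assms by (auto simp: m_assoc)
  thus "conj_set W (inv w) (conj_set W w K) = K" "conj_set W w (conj_set W (inv w) K) = K"
    unfolding conj_set_def image_image by (auto cong: image_cong)
qed

end

section \<open>Stages of the recursion\<close>

locale parabolic_iso = A: coxeter_group W1 I1 + B: coxeter_group W2 I2
  for W1 :: "('a, 'k) monoid_scheme" and I1 and W2 :: "('b, 'l) monoid_scheme" and I2 +
  fixes J1 :: "'a set" and J2 :: "'b set" and \<delta> :: "'a \<Rightarrow> 'b"
  assumes J1: "J1 \<subseteq> I1" and J2: "J2 \<subseteq> I2"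
    and iso: "\<delta> \<in> iso (parabolic W1 J1) (parabolic W2 J2)" and image_gens: "\<delta> ` J1 = J2"
begin

abbreviation \<epsilon> :: "'b \<Rightarrow> 'a" where "\<epsilon> \<equiv> inv_into (generate W1 J1) \<delta>"

lemma bij: "bij_betw \<delta> (generate W1 J1) (generate W2 J2)"
  using iso by (auto simp: iso_def)

lemma closed: "x \<in> generate W1 J1 \<Longrightarrow> \<delta> x \<in> generate W2 J2"
  using bij by (auto simp: bij_betw_def)

lemma hom_mult: "x \<in> generate W1 J1 \<Longrightarrow> y \<in> generate W1 J1 \<Longrightarrow> \<delta> (x \<otimes>\<^bsub>W1\<^esub> y) = \<delta> x \<otimes>\<^bsub>W2\<^esub> \<delta> y"
  using iso by (auto simp: iso_def hom_def)

lemma hom_one [simp]: "\<delta> \<one>\<^bsub>W1\<^esub> = \<one>\<^bsub>W2\<^esub>"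
proof -
  have *: "\<one>\<^bsub>W1\<^esub> \<in> generate W1 J1" by (rule generate.one)
  have "\<delta> \<one>\<^bsub>W1\<^esub> \<in> carrier W2" using closed[OF *] B.gen_closed[OF J2] by blast
  with hom_mult[OF * *] show ?thesis by simp
qed

lemma hom_inv: assumes "x \<in> generate W1 J1" shows "\<delta> (inv\<^bsub>W1\<^esub> x) = inv\<^bsub>W2\<^esub> \<delta> x"
proof -
  have x: "inv\<^bsub>W1\<^esub> x \<in> generate W1 J1" using assms A.gen_inv J1 by blast
  have "\<delta> (inv\<^bsub>W1\<^esub> x) \<otimes>\<^bsub>W2\<^esub> \<delta> x = \<one>\<^bsub>W2\<^esub>"
    using hom_mult[OF x assms] A.gen_closed[OF J1 assms] by simp
  thus ?thesis using x assms closed B.gen_closed[OF J2] B.inv_equality by metis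
qed

lemma gen_image: assumes "K \<subseteq> J1" "k \<in> generate W1 K" shows "\<delta> k \<in> generate W2 (\<delta> ` K)"
  using assms(2)
proof induction
  case one thus ?case by (simp add: generate.one)
next
  case (incl h) thus ?case by (auto intro: generate.incl)
next
  case (inv h)
  hence "\<delta> (inv\<^bsub>W1\<^esub> h) = inv\<^bsub>W2\<^esub> \<delta> h" using assms by (intro hom_inv) (auto intro: generate.incl)
  thus ?case using inv by (auto intro: generate.inv)
next
  case (eng x y)
  hence "x \<in> generate W1 J1" "y \<in> generate W1 J1" using A.gen_mono[OF assms(1)] by blast+
  thus ?case using eng.IH by (simp add: hom_mult generate.eng)
qed

lemma back_closed: "y \<in> generate W2 J2 \<Longrightarrow> \<epsilon> y \<in> generate W1 J1"
  using bij by (metis bij_betw_def inv_into_into)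

lemma back_left: "x \<in> generate W1 J1 \<Longrightarrow> \<epsilon> (\<delta> x) = x"
  using bij by (rule bij_betw_inv_into_left)

lemma back_right: "y \<in> generate W2 J2 \<Longrightarrow> \<delta> (\<epsilon> y) = y"
  using bij by (rule bij_betw_inv_into_right)

lemma back_image: "K \<subseteq> J1 \<Longrightarrow> \<epsilon> ` \<delta> ` K = K"
  using back_left by (force simp: image_image intro: generate.incl)

text \<open>The situation is symmetric, which transfers facts about \<delta> to \<epsilon>.\<close>

lemma flip: "parabolic_iso W2 I2 W1 I1 J2 J1 \<epsilon>"
proof unfold_locales
  have "group (parabolic W1 J1)"
    using A.subgroup_imp_group[OF A.gen_subgroup[OF J1]] .
  from group.iso_set_sym[OF this iso] show "\<epsilon> \<in> iso (parabolic W2 J2) (parabolic W1 J1)" by simp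
  show "\<epsilon> ` J2 = J1" using back_image image_gens by blast
qed (fact J1 J2)+

lemma back_gen_image: "K \<subseteq> J2 \<Longrightarrow> k \<in> generate W2 K \<Longrightarrow> \<epsilon> k \<in> generate W1 (\<epsilon> ` K)"
  using parabolic_iso.gen_image[OF flip] .

lemma back_mult:
  "x \<in> generate W2 J2 \<Longrightarrow> y \<in> generate W2 J2 \<Longrightarrow> \<epsilon> (x \<otimes>\<^bsub>W2\<^esub> y) = \<epsilon> x \<otimes>\<^bsub>W1\<^esub> \<epsilon> y"
  using parabolic_iso.hom_mult[OF flip] .

lemma carrier_dom: "x \<in> generate W1 J1 \<Longrightarrow> x \<in> carrier W1"
  using A.gen_closed J1 by blast

lemma carrier_ran: "x \<in> generate W1 J1 \<Longrightarrow> \<delta> x \<in> carrier W2"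
  using B.gen_closed J2 closed by blast

lemma carrier_back: "x \<in> generate W2 J2 \<Longrightarrow> \<epsilon> x \<in> carrier W1"
  using A.gen_closed J1 back_closed by blast

end

section \<open>A single stage of the recursion for two admissible triples\<close>

locale triple_pair = A: coxeter_group W1 I1 + B: coxeter_group W2 I2 +
  c: parabolic_iso W1 I1 W2 I2 J1 J2 \<delta> + c': parabolic_iso W1 I1 W2 I2 J1' J2' \<delta>'
  for W1 :: "('a, 'k) monoid_scheme" and I1 and W2 :: "('b, 'l) monoid_scheme" and I2
    and J1 J2 \<delta> J1' J2' \<delta>'
begin

notation c.\<epsilon> ("\<epsilon>")
abbreviation mult1 (infixl "\<cdot>" 70) where "x \<cdot> y \<equiv> x \<otimes>\<^bsub>W1\<^esub> y"
abbreviation mult2 (infixl "\<star>" 70) where "x \<star> y \<equiv> x \<otimes>\<^bsub>W2\<^esub> y"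
abbreviation inv1 where "inv1 x \<equiv> inv\<^bsub>W1\<^esub> x"
abbreviation inv2 where "inv2 x \<equiv> inv\<^bsub>W2\<^esub> x"

text \<open>With \<open>d = stage_w2 S\<close> and \<open>K = stage_J2 S\<close> this is the set of
  simple reflections that the recursion passes on to the stage after \<open>S\<close>.\<close>

definition next_subset :: "'b \<Rightarrow> 'b set \<Rightarrow> 'a set" where
  "next_subset d K = \<epsilon> ` (conj_set W2 (inv2 d) K \<inter> J2)"

text \<open>Replaces the cosets and minima of \<open>make_stage\<close> by factorisations with
  minimal factors, the form in which the double coset lemmas apply. It also records that
  \<open>stage_w1 S\<close> and \<open>stage_w2 S\<close> are minimal from both sides.\<close>

definition is_stage :: "'a set \<Rightarrow> 'a \<Rightarrow> 'b \<Rightarrow> ('a, 'b) stage \<Rightarrow> bool" where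
  "is_stage J x y S \<longleftrightarrow>
     J \<subseteq> J1 \<and> x \<in> carrier W1 \<and> y \<in> carrier W2 \<and> stage_J1 S = J \<and>
     stage_u1 S \<in> A.left_reps J1' \<and> stage_v1 S \<in> A.gen J1' \<and> x = stage_v1 S \<cdot> stage_u1 S \<and>
     stage_w1 S \<in> A.left_reps J1' \<and> stage_w1 S \<in> A.right_reps J \<and>
     (\<exists>t\<in>A.gen J. stage_u1 S = stage_w1 S \<cdot> t) \<and>
     stage_J2 S = \<delta>' ` (conj_set W1 (stage_w1 S) J \<inter> J1') \<and>
     stage_u2 S \<in> B.right_reps J2 \<and> stage_v2 S \<in> B.gen J2 \<and>
     inv2 (\<delta>' (stage_v1 S)) \<star> y = stage_u2 S \<star> stage_v2 S \<and>
     stage_w2 S \<in> B.left_reps (stage_J2 S) \<and> stage_w2 S \<in> B.right_reps J2 \<and>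
     (\<exists>t\<in>B.gen (stage_J2 S). stage_u2 S = t \<star> stage_w2 S)"

lemma is_stage_make_stage:
  assumes J: "J \<subseteq> J1" and x: "x \<in> carrier W1" and y: "y \<in> carrier W2"
  shows "is_stage J x y (make_stage W1 I1 W2 I2 (J1, J2, \<delta>) (J1', J2', \<delta>') J x y)"
proof -
  obtain v1 u1 where u1: "v1 \<in> A.gen J1'" "u1 \<in> A.left_reps J1'" "x = v1 \<cdot> u1"
    using A.left_reps_decomp[OF c'.J1 x] by blast
  have JI: "J \<subseteq> I1" using J c.J1 by blast
  have u1c: "u1 \<in> carrier W1" using u1 A.left_reps_closed by blast
  obtain t w1 where w1: "t \<in> A.gen J" "w1 \<in> A.right_reps J" "u1 = w1 \<cdot> t"
    using A.right_reps_decomp[OF JI u1c] by blast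
  have w1L: "w1 \<in> A.left_reps J1'"
    using A.left_reps_of_mult[OF c'.J1 JI w1(2,1)] u1(2) w1(3) by simp
  let ?K = "\<delta>' ` (conj_set W1 w1 J \<inter> J1')"
  have KI: "?K \<subseteq> I2" using c'.image_gens c'.J2 by blast
  have dv: "\<delta>' v1 \<in> carrier W2" using u1 c'.carrier_ran by blast
  obtain v2 u2 where u2: "v2 \<in> B.gen J2" "u2 \<in> B.right_reps J2" "inv2 (\<delta>' v1) \<star> y = u2 \<star> v2"
    using B.right_reps_decomp[OF c.J2, of "inv2 (\<delta>' v1) \<star> y"] dv y by auto
  have u2c: "u2 \<in> carrier W2" using u2 B.right_reps_closed by blast
  obtain t2 w2 where w2: "t2 \<in> B.gen ?K" "w2 \<in> B.left_reps ?K" "u2 = t2 \<star> w2"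
    using B.left_reps_decomp[OF KI u2c] by blast
  have w2R: "w2 \<in> B.right_reps J2"
    using B.right_reps_of_mult[OF KI c.J2 w2(2,1)] u2(2) w2(3) by simp
  have v1c: "v1 \<in> carrier W1" and v2c: "v2 \<in> carrier W2"
    using u1 u2 c'.carrier_dom B.gen_closed[OF c.J2] by blast+
  have v1: "x \<cdot> inv1 u1 = v1" using u1(3) u1c v1c by (simp add: A.m_assoc)
  have v2: "inv2 u2 \<star> inv2 (\<delta>' v1) \<star> y = v2"
    using u2(3) u2c v2c dv y by (simp add: B.m_assoc)
  have "make_stage W1 I1 W2 I2 (J1, J2, \<delta>) (J1', J2', \<delta>') J x y =
    \<lparr>stage_J1 = J, stage_u1 = u1, stage_w1 = w1, stage_v1 = v1,
     stage_J2 = ?K, stage_u2 = u2, stage_w2 = w2, stage_v2 = v2\<rparr>"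
  proof -
    have e1: "coset_min W1 I1 (A.gen J1' #>\<^bsub>W1\<^esub> x) = u1"
      using A.coset_min_left[OF c'.J1 u1(2,1)] u1(3) by simp
    have e2: "coset_min W1 I1 (u1 <#\<^bsub>W1\<^esub> A.gen J) = w1"
      using A.coset_min_right[OF JI w1(2,1)] w1(3) by simp
    have e3: "coset_min W2 I2 ((inv2 (\<delta>' v1) \<star> y) <#\<^bsub>W2\<^esub> B.gen J2) = u2"
      using B.coset_min_right[OF c.J2 u2(2,1)] u2(3) by simp
    have e4: "coset_min W2 I2 (B.gen ?K #>\<^bsub>W2\<^esub> u2) = w2"
      using B.coset_min_left[OF KI w2(2,1)] w2(3) by simp
    show ?thesis unfolding make_stage.simps Let_def e1 e2 v1 e3 e4 v2 ..
  qed
  thus ?thesis using assms u1 w1 w1L u2 w2 w2R unfolding is_stage_def by auto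
qed

lemma next_stage_eq:
  "next_stage W1 I1 W2 I2 (J1, J2, \<delta>) (J1', J2', \<delta>') S =
   make_stage W1 I1 W2 I2 (J1, J2, \<delta>) (J1', J2', \<delta>') (next_subset (stage_w2 S) (stage_J2 S))
     (stage_u1 S \<cdot> inv1 (\<epsilon> (stage_v2 S))) (stage_u2 S)"
  by (simp add: next_subset_def)

lemma next_subset_subset: "next_subset d K \<subseteq> J1"
  unfolding next_subset_def using parabolic_iso.image_gens[OF c.flip] by blast

context
  fixes J x y S assumes S: "is_stage J x y S"
begin

lemma stageD:
  "J \<subseteq> J1" "stage_J1 S = J"
  "stage_u1 S \<in> A.left_reps J1'" "stage_v1 S \<in> A.gen J1'" "x = stage_v1 S \<cdot> stage_u1 S"
  "stage_w1 S \<in> A.left_reps J1'" "stage_w1 S \<in> A.right_reps J"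
  "\<exists>t\<in>A.gen J. stage_u1 S = stage_w1 S \<cdot> t"
  "stage_J2 S = \<delta>' ` (conj_set W1 (stage_w1 S) J \<inter> J1')"
  "stage_u2 S \<in> B.right_reps J2" "stage_v2 S \<in> B.gen J2"
  "inv2 (\<delta>' (stage_v1 S)) \<star> y = stage_u2 S \<star> stage_v2 S"
  "stage_w2 S \<in> B.left_reps (stage_J2 S)" "stage_w2 S \<in> B.right_reps J2"
  "\<exists>t\<in>B.gen (stage_J2 S). stage_u2 S = t \<star> stage_w2 S"
  using S unfolding is_stage_def by blast+

lemma stage_carrier:
  "J \<subseteq> I1" "stage_J2 S \<subseteq> J2'" "stage_J2 S \<subseteq> I2"
  "stage_u1 S \<in> carrier W1" "stage_v1 S \<in> carrier W1" "stage_w1 S \<in> carrier W1"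
  "stage_u2 S \<in> carrier W2" "stage_v2 S \<in> carrier W2" "stage_w2 S \<in> carrier W2"
  "\<delta>' (stage_v1 S) \<in> carrier W2" "\<epsilon> (stage_v2 S) \<in> carrier W1"
  "\<epsilon> (stage_v2 S) \<in> A.gen J1"
proof -
  show "J \<subseteq> I1" using stageD(1) c.J1 by blast
  show "stage_J2 S \<subseteq> J2'" "stage_J2 S \<subseteq> I2"
    unfolding stageD(9) using c'.image_gens c'.J2 by blast+
  show "stage_u1 S \<in> carrier W1" using stageD(3) by (rule A.left_reps_closed)
  show "stage_w1 S \<in> carrier W1" using stageD(6) by (rule A.left_reps_closed)
  show "stage_v1 S \<in> carrier W1" using stageD(4) by (rule c'.carrier_dom)
  show "stage_u2 S \<in> carrier W2" using stageD(10) by (rule B.right_reps_closed)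
  show "stage_w2 S \<in> carrier W2" using stageD(13) by (rule B.left_reps_closed)
  show "stage_v2 S \<in> carrier W2" using stageD(11) B.gen_closed[OF c.J2] by blast
  show "\<delta>' (stage_v1 S) \<in> carrier W2" using stageD(4) by (rule c'.carrier_ran)
  show "\<epsilon> (stage_v2 S) \<in> carrier W1" using stageD(11) by (rule c.carrier_back)
  show "\<epsilon> (stage_v2 S) \<in> A.gen J1" using stageD(11) by (rule c.back_closed)
qed

lemma left_image_gen:
  assumes "k \<in> A.gen (conj_set W1 (stage_w1 S) J \<inter> J1')"
  shows "\<delta>' k \<in> B.gen (stage_J2 S)"
proof -
  have "\<delta>' k \<in> B.gen (\<delta>' ` (conj_set W1 (stage_w1 S) J \<inter> J1'))"
    using c'.gen_image[OF _ assms] by blast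
  thus ?thesis using S unfolding is_stage_def by metis
qed

lemma right_image_gen:
  assumes "k \<in> B.gen (conj_set W2 (inv2 (stage_w2 S)) (stage_J2 S) \<inter> J2)"
  shows "\<epsilon> k \<in> A.gen (next_subset (stage_w2 S) (stage_J2 S))"
  using c.back_gen_image[OF _ assms] unfolding next_subset_def by blast

lemma next_input_carrier:
  "stage_u1 S \<cdot> inv1 (\<epsilon> (stage_v2 S)) \<in> carrier W1" "stage_u2 S \<in> carrier W2"
  using stage_carrier by auto

lemma is_stage_next:
  "is_stage (next_subset (stage_w2 S) (stage_J2 S)) (stage_u1 S \<cdot> inv1 (\<epsilon> (stage_v2 S))) (stage_u2 S)
     (next_stage W1 I1 W2 I2 (J1, J2, \<delta>) (J1', J2', \<delta>') S)"
  unfolding next_stage_eq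
  using is_stage_make_stage next_subset_subset next_input_carrier by blast

end

text \<open>Once \<open>\<epsilon> v\<^sub>2 \<in> W\<^sub>J\<close>, all later stages stay in the cosets \<open>w\<^sub>1 W\<^sub>J\<close> and \<open>W\<^sub>J\<^sub>' w\<^sub>2\<close>; this is what
  makes the sets \<open>J\<close> decrease.\<close>

lemma stage_step:
  fixes S :: "('a, 'b) stage"
  defines "Jn \<equiv> next_subset (stage_w2 S) (stage_J2 S)"
  assumes S: "is_stage J x y S" and v2: "\<epsilon> (stage_v2 S) \<in> A.gen J" and Jn: "Jn \<subseteq> J"
    and S': "is_stage Jn (stage_u1 S \<cdot> inv1 (\<epsilon> (stage_v2 S))) (stage_u2 S) S'"
  shows "\<epsilon> (stage_v2 S') \<in> A.gen Jn" "next_subset (stage_w2 S') (stage_J2 S') \<subseteq> Jn"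
    "\<exists>t\<in>A.gen J. stage_w1 S' = stage_w1 S \<cdot> t"
    "\<exists>t\<in>B.gen (stage_J2 S). stage_w2 S' = t \<star> stage_w2 S"
proof -
  note D = stageD[OF S] and D' = stageD[OF S'] and C = stage_carrier[OF S] and C' = stage_carrier[OF S']
  obtain t where t: "t \<in> A.gen J" "stage_u1 S = stage_w1 S \<cdot> t" using D(8) by blast
  have tc: "t \<in> carrier W1" using t C(1) A.gen_closed by blast
  let ?t = "t \<cdot> inv1 (\<epsilon> (stage_v2 S))"
  have tJ: "?t \<in> A.gen J" using t v2 C(1) by (intro A.gen_mult A.gen_inv)
  \<comment> \<open>The input of the new stage lies in the coset of the old
    \<open>stage_w1 S\<close>. Factoring it confines the new \<open>stage_v1 S'\<close> to a
    parabolic subgroup and keeps the new \<open>stage_u1 S'\<close> in that coset.\<close>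
  have "stage_w1 S \<cdot> ?t = stage_v1 S' \<cdot> stage_u1 S'"
    using D'(5) t(2) C tc by (simp add: A.m_assoc)
  note L = A.left_factor_parabolic[OF c'.J1 C(1) D(6,7) tJ D'(4,3) this]
  from L(2) obtain t' where t': "t' \<in> A.gen J" "stage_u1 S' = stage_w1 S \<cdot> t'" by blast
  have t'c: "t' \<in> carrier W1" using t' C(1) A.gen_closed by blast
  obtain t1 where t1: "t1 \<in> A.gen Jn" "stage_u1 S' = stage_w1 S' \<cdot> t1" using D'(8) by blast
  have t1J: "t1 \<in> A.gen J" using t1 Jn A.gen_mono by blast
  have t1c: "t1 \<in> carrier W1" using t1J C(1) A.gen_closed by blast
  have "stage_w1 S' = stage_u1 S' \<cdot> inv1 t1" using t1 t1c C' by (simp add: A.m_assoc)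
  hence w1: "stage_w1 S' = stage_w1 S \<cdot> (t' \<cdot> inv1 t1)"
    using t' t1c t'c C by (simp add: A.m_assoc)
  have tt: "t' \<cdot> inv1 t1 \<in> A.gen J" using t' t1J C(1) by (intro A.gen_mult A.gen_inv)
  show "\<exists>t\<in>A.gen J. stage_w1 S' = stage_w1 S \<cdot> t" using w1 tt by blast
  \<comment> \<open>The two values of \<open>stage_w1\<close> differ by an element of W_J and
    \<open>J\<close> shrinks, so monotonicity of the intersected conjugates applies.\<close>
  have K: "stage_J2 S' \<subseteq> stage_J2 S"
    using A.conj_set_Int_mono[OF c'.J1 C(1) D(6,7) tt Jn] unfolding D(9) D'(9) w1 by (intro image_mono)
  have dv: "\<delta>' (stage_v1 S') \<in> B.gen (stage_J2 S)" using left_image_gen[OF S L(1)] .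
  obtain s where s: "s \<in> B.gen (stage_J2 S)" "stage_u2 S = s \<star> stage_w2 S" using D(15) by blast
  have sc: "s \<in> carrier W2" using s C(3) B.gen_closed by blast
  let ?s = "inv2 (\<delta>' (stage_v1 S')) \<star> s"
  have sK: "?s \<in> B.gen (stage_J2 S)" using s dv C(3) by (intro B.gen_mult B.gen_inv)
  \<comment> \<open>The mirror image in \<open>W2\<close>: the correction by
    \<open>stage_v1 S'\<close> has been confined to the group of \<open>stage_J2 S\<close>, so the
    element to be factored stays in the coset of \<open>stage_w2 S\<close>.\<close>
  have "?s \<star> stage_w2 S = stage_u2 S' \<star> stage_v2 S'"
    using D'(12) s(2) C C' sc by (simp add: B.m_assoc)
  note R = B.right_factor_parabolic[OF C(3) c.J2 D(13,14) sK D'(11,10) this]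
  show "\<epsilon> (stage_v2 S') \<in> A.gen Jn" unfolding Jn_def using right_image_gen[OF S R(1)] .
  from R(2) obtain s' where s': "s' \<in> B.gen (stage_J2 S)" "stage_u2 S' = s' \<star> stage_w2 S" by blast
  have s'c: "s' \<in> carrier W2" using s' C(3) B.gen_closed by blast
  obtain s1 where s1: "s1 \<in> B.gen (stage_J2 S')" "stage_u2 S' = s1 \<star> stage_w2 S'" using D'(15) by blast
  have s1K: "s1 \<in> B.gen (stage_J2 S)" using s1 K B.gen_mono by blast
  have s1c: "s1 \<in> carrier W2" using s1K C(3) B.gen_closed by blast
  have "stage_w2 S' = inv2 s1 \<star> stage_u2 S'" using s1 s1c C' by simp
  hence w2: "stage_w2 S' = inv2 s1 \<star> s' \<star> stage_w2 S" using s' s1c s'c C by (simp add: B.m_assoc)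
  have ss: "inv2 s1 \<star> s' \<in> B.gen (stage_J2 S)" using s' s1K C(3) by (intro B.gen_mult B.gen_inv)
  show "\<exists>t\<in>B.gen (stage_J2 S). stage_w2 S' = t \<star> stage_w2 S" using w2 ss by blast
  show "next_subset (stage_w2 S') (stage_J2 S') \<subseteq> Jn"
    using B.conj_set_inv_Int_mono[OF C(3) c.J2 D(13,14) ss K] unfolding Jn_def next_subset_def w2
    by (intro image_mono)
qed

section \<open>Sets of simple reflections that both triples match up\<close>

definition balanced :: "'a \<Rightarrow> 'b \<Rightarrow> 'a set \<Rightarrow> bool" where
  "balanced w1 w2 K \<longleftrightarrow> K \<subseteq> J1 \<and> conj_set W1 w1 K \<subseteq> J1' \<and>
     \<delta>' ` conj_set W1 w1 K = conj_set W2 w2 (\<delta> ` K)"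

definition largest :: "'a \<Rightarrow> 'b \<Rightarrow> 'a set" where
  "largest w1 w2 = \<Union> {K. balanced w1 w2 K}"

text \<open>The conditions are inclusions and equalities between images, and images commute with
  unions; this is why the \<open>GREATEST\<close> in \<open>stable_subset\<close> exists.\<close>

lemma balanced_largest: "balanced w1 w2 (largest w1 w2)"
  unfolding largest_def balanced_def conj_set_def by blast

lemma balanced_subset_largest: "balanced w1 w2 K \<Longrightarrow> K \<subseteq> largest w1 w2"
  unfolding largest_def by blast

lemma stable_subset_eq_largest:
  "stable_subset W1 W2 (J1, J2, \<delta>) (J1', J2', \<delta>') w1 w2 = largest w1 w2"
proof -
  have "(GREATEST K. balanced w1 w2 K) = largest w1 w2"
    using balanced_largest balanced_subset_largest by (intro Greatest_equality) auto
  thus ?thesis by (simp add: balanced_def)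
qed

text \<open>Passing from \<open>J\<close> to the next set alternates images with intersections, none
  of which increases cardinality. If the result is \<open>J\<close> again, neither intersection
  removes an element, and the matching condition remains.\<close>

lemma balanced_stage:
  assumes S: "is_stage J x y S" and J: "next_subset (stage_w2 S) (stage_J2 S) = J"
  shows "balanced (stage_w1 S) (stage_w2 S) J"
    "stage_J2 S = \<delta>' ` conj_set W1 (stage_w1 S) J"
proof -
  note D = stageD[OF S] and C = stage_carrier[OF S]
  let ?X = "conj_set W1 (stage_w1 S) J" and ?Y = "conj_set W2 (inv2 (stage_w2 S)) (stage_J2 S)"
  have fin: "finite J" using C(1) A.finite_generators finite_subset by blast
  hence finX: "finite ?X" by (simp add: conj_set_def)
  hence "finite (stage_J2 S)" unfolding D(9) by simp
  hence finY: "finite ?Y" by (simp add: conj_set_def)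
  have "card J \<le> card (?Y \<inter> J2)"
    using J finY unfolding next_subset_def by (metis card_image_le finite_Int)
  moreover have "card (?Y \<inter> J2) \<le> card ?Y" using finY by (intro card_mono) auto
  moreover have "card ?Y \<le> card (stage_J2 S)"
    unfolding conj_set_def using finX D(9) by (intro card_image_le) simp
  moreover have "card (stage_J2 S) \<le> card (?X \<inter> J1')"
    unfolding D(9) using finX by (intro card_image_le) simp
  moreover have "card (?X \<inter> J1') \<le> card ?X" using finX by (intro card_mono) auto
  moreover have "card ?X \<le> card J" unfolding conj_set_def using fin by (intro card_image_le)
  ultimately have "card (?Y \<inter> J2) = card ?Y" "card (?X \<inter> J1') = card ?X" by linarith+
  hence "?Y \<inter> J2 = ?Y" "?X \<inter> J1' = ?X" using card_subset_eq[OF finY Int_lower1] card_subset_eq[OF finX Int_lower1] by blast+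
  hence Y: "?Y \<subseteq> J2" and X: "?X \<subseteq> J1'" by blast+
  show J2S: "stage_J2 S = \<delta>' ` ?X" using D(9) X by (simp add: Int_absorb2)
  have "\<delta> ` J = \<delta> ` \<epsilon> ` ?Y" using J Y unfolding next_subset_def by (simp add: Int_absorb2)
  also have "\<dots> = ?Y" using Y c.back_right by (force simp: image_image intro: generate.incl)
  finally have "conj_set W2 (stage_w2 S) (\<delta> ` J) = stage_J2 S"
    using B.conj_set_inv_conj_set(2)[of "stage_J2 S" "stage_w2 S"] C B.generators_closed by auto
  thus "balanced (stage_w1 S) (stage_w2 S) J" unfolding balanced_def using X J2S D(1) by simp
qed

lemma balanced_conj:
  assumes "balanced d e J" "d \<in> carrier W1" "t \<in> A.gen J"
  shows "d \<cdot> t \<cdot> inv1 d \<in> A.gen (conj_set W1 d J)" "d \<cdot> t \<cdot> inv1 d \<in> A.gen J1'"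
proof -
  have "J \<subseteq> carrier W1" "conj_set W1 d J \<subseteq> J1'"
    using assms(1) c.J1 A.generators_closed unfolding balanced_def by blast+
  thus "d \<cdot> t \<cdot> inv1 d \<in> A.gen (conj_set W1 d J)" "d \<cdot> t \<cdot> inv1 d \<in> A.gen J1'"
    using A.conj_gen assms A.gen_mono by blast+
qed

lemma balanced_inv_conj:
  assumes "balanced d e J" "d \<in> carrier W1" "t \<in> A.gen (conj_set W1 d J)"
  shows "inv1 d \<cdot> t \<cdot> d \<in> A.gen J"
proof -
  have J: "J \<subseteq> carrier W1" using assms(1) c.J1 A.generators_closed unfolding balanced_def by blast
  have "conj_set W1 d J \<subseteq> carrier W1" using J assms(2) by (auto simp: conj_set_def)
  from A.conj_gen[OF this _ assms(3), of "inv1 d"]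
  show ?thesis using assms(2) A.conj_set_inv_conj_set(1)[OF J assms(2)] by simp
qed

lemma balanced_images:
  assumes "balanced d e J"
  shows "J \<subseteq> J1" "J \<subseteq> I1" "\<delta> ` J \<subseteq> J2" "\<delta> ` J \<subseteq> I2" "conj_set W2 e (\<delta> ` J) \<subseteq> J2'"
    "conj_set W2 e (\<delta> ` J) \<subseteq> I2" "conj_set W1 d J \<subseteq> J1'" "conj_set W1 d J \<subseteq> I1"
proof -
  have b: "J \<subseteq> J1" "conj_set W1 d J \<subseteq> J1'" "\<delta>' ` conj_set W1 d J = conj_set W2 e (\<delta> ` J)"
    using assms unfolding balanced_def by auto
  thus "J \<subseteq> J1" "J \<subseteq> I1" "conj_set W1 d J \<subseteq> J1'" "conj_set W1 d J \<subseteq> I1"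
    using c.J1 c'.J1 by auto
  show "\<delta> ` J \<subseteq> J2" "\<delta> ` J \<subseteq> I2" using b(1) c.image_gens c.J2 by blast+
  have "conj_set W2 e (\<delta> ` J) \<subseteq> \<delta>' ` J1'" using b(2) unfolding b(3)[symmetric] by blast
  thus "conj_set W2 e (\<delta> ` J) \<subseteq> J2'" "conj_set W2 e (\<delta> ` J) \<subseteq> I2"
    using c'.image_gens c'.J2 by blast+
qed

lemma balanced_right_conj:
  assumes "balanced d e J" "e \<in> carrier W2" "t \<in> B.gen (conj_set W2 e (\<delta> ` J))"
  shows "inv2 e \<star> t \<star> e \<in> B.gen (\<delta> ` J)"
proof -
  have J: "\<delta> ` J \<subseteq> carrier W2" "conj_set W2 e (\<delta> ` J) \<subseteq> carrier W2"
    using balanced_images[OF assms(1)] B.generators_closed by blast+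
  from B.conj_gen[OF J(2) _ assms(3), of "inv2 e"]
  show ?thesis using assms(2) B.conj_set_inv_conj_set(1)[OF J(1) assms(2)] by simp
qed

text \<open>Conjugation by \<open>d\<close> carries W_J into the group of \<open>J1'\<close>, so d t
  lies in the same coset of that group as \<open>d\<close>, and a coset has only one minimal
  element.\<close>

lemma balanced_left_unique:
  assumes "balanced d e J" "d \<in> A.left_reps J1'" "d \<cdot> t \<in> A.left_reps J1'" "t \<in> A.gen J"
  shows "d \<cdot> t = d"
proof -
  have c: "d \<in> carrier W1" "t \<in> carrier W1"
    using assms A.left_reps_closed A.gen_closed balanced_images(2) by blast+
  have "d \<cdot> t = (d \<cdot> t \<cdot> inv1 d) \<cdot> d" using c by (simp add: A.m_assoc)
  thus ?thesis
    using A.left_reps_unique(1)[OF c'.J1 assms(3,2) balanced_conj(2)[OF assms(1) c(1) assms(4)]] by simp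
qed

lemma balanced_right_unique:
  assumes "balanced d e J" "e \<in> B.right_reps J2" "t \<star> e \<in> B.right_reps J2"
    "t \<in> B.gen (conj_set W2 e (\<delta> ` J))"
  shows "t \<star> e = e"
proof -
  have c: "e \<in> carrier W2" "t \<in> carrier W2"
    using assms B.right_reps_closed B.gen_closed balanced_images(6) by blast+
  have "t \<star> e = e \<star> (inv2 e \<star> t \<star> e)" using c by (simp add: B.m_assoc)
  moreover have "inv2 e \<star> t \<star> e \<in> B.gen J2"
    using balanced_right_conj[OF assms(1) c(1) assms(4)] balanced_images(3)[OF assms(1)] B.gen_mono by blast
  ultimately show ?thesis
    using B.right_reps_unique[OF c.J2 assms(3,2)] by simp
qed

section \<open>Pairs in a common double coset of W_c' and W_c\<close>

definition linked :: "'a \<times> 'b \<Rightarrow> 'a \<times> 'b \<Rightarrow> bool" where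
  "linked p q \<longleftrightarrow> (\<exists>a\<in>A.gen J1'. \<exists>b\<in>A.gen J1.
     fst q = a \<cdot> fst p \<cdot> b \<and> snd q = \<delta>' a \<star> snd p \<star> \<delta> b)"

lemma linkedI:
  "a \<in> A.gen J1' \<Longrightarrow> b \<in> A.gen J1 \<Longrightarrow> x' = a \<cdot> x \<cdot> b \<Longrightarrow> y' = \<delta>' a \<star> y \<star> \<delta> b \<Longrightarrow>
   linked (x, y) (x', y')"
  unfolding linked_def by auto

lemma linked_refl:
  assumes "p \<in> carrier W1 \<times> carrier W2" shows "linked p p"
  unfolding linked_def using assms
  by (intro bexI[of _ "\<one>\<^bsub>W1\<^esub>"]) (auto intro: generate.one)

lemma linked_carrier:
  "linked p q \<Longrightarrow> p \<in> carrier W1 \<times> carrier W2 \<Longrightarrow> q \<in> carrier W1 \<times> carrier W2"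
  unfolding linked_def using c.carrier_dom c.carrier_ran c'.carrier_dom c'.carrier_ran
  by (cases q) (force simp: mem_Times_iff)

lemma linked_sym:
  assumes "p \<in> carrier W1 \<times> carrier W2" "linked p q" shows "linked q p"
proof -
  obtain a b where *: "a \<in> A.gen J1'" "b \<in> A.gen J1"
    "fst q = a \<cdot> fst p \<cdot> b" "snd q = \<delta>' a \<star> snd p \<star> \<delta> b"
    using assms(2) unfolding linked_def by blast
  have c: "a \<in> carrier W1" "b \<in> carrier W1" "\<delta>' a \<in> carrier W2" "\<delta> b \<in> carrier W2"
    "fst p \<in> carrier W1" "snd p \<in> carrier W2"
    using * c.carrier_dom c.carrier_ran c'.carrier_dom c'.carrier_ran assms(1) by auto
  have "fst p = inv1 a \<cdot> fst q \<cdot> inv1 b" "snd p = \<delta>' (inv1 a) \<star> snd q \<star> \<delta> (inv1 b)"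
    using c * by (simp_all add: A.m_assoc B.m_assoc c.hom_inv c'.hom_inv)
  thus ?thesis unfolding linked_def using * A.gen_inv c.J1 c'.J1 by blast
qed

lemma linked_trans:
  assumes "p \<in> carrier W1 \<times> carrier W2" "linked p q" "linked q r" shows "linked p r"
proof -
  obtain a b where *: "a \<in> A.gen J1'" "b \<in> A.gen J1"
    "fst q = a \<cdot> fst p \<cdot> b" "snd q = \<delta>' a \<star> snd p \<star> \<delta> b"
    using assms(2) unfolding linked_def by blast
  obtain a' b' where r: "a' \<in> A.gen J1'" "b' \<in> A.gen J1"
    "fst r = a' \<cdot> fst q \<cdot> b'" "snd r = \<delta>' a' \<star> snd q \<star> \<delta> b'"
    using assms(3) unfolding linked_def by blast
  have c: "a \<in> carrier W1" "b \<in> carrier W1" "\<delta>' a \<in> carrier W2" "\<delta> b \<in> carrier W2"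
    "a' \<in> carrier W1" "b' \<in> carrier W1" "\<delta>' a' \<in> carrier W2" "\<delta> b' \<in> carrier W2"
    "fst p \<in> carrier W1" "snd p \<in> carrier W2"
    using * r c.carrier_dom c.carrier_ran c'.carrier_dom c'.carrier_ran assms(1) by auto
  have "fst r = (a' \<cdot> a) \<cdot> fst p \<cdot> (b \<cdot> b')" "snd r = \<delta>' (a' \<cdot> a) \<star> snd p \<star> \<delta> (b \<cdot> b')"
    using c * r by (simp_all add: A.m_assoc B.m_assoc c.hom_mult c'.hom_mult)
  thus ?thesis unfolding linked_def using * r A.gen_mult by blast
qed

text \<open>The next input arises by multiplying with the inverses of \<open>stage_v1 S\<close> and
  of its image on the left, and with the inverses of \<open>\<epsilon> (stage_v2 S)\<close> and
  \<open>stage_v2 S\<close> on the right.\<close>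

lemma stage_linked:
  assumes S: "is_stage J x y S"
  shows "linked (x, y) (stage_u1 S \<cdot> inv1 (\<epsilon> (stage_v2 S)), stage_u2 S)"
proof (rule linkedI)
  note D = stageD[OF S] and C = stage_carrier[OF S]
  show "inv1 (stage_v1 S) \<in> A.gen J1'" "inv1 (\<epsilon> (stage_v2 S)) \<in> A.gen J1"
    using D C A.gen_inv c.J1 c'.J1 by blast+
  show "stage_u1 S \<cdot> inv1 (\<epsilon> (stage_v2 S)) = inv1 (stage_v1 S) \<cdot> x \<cdot> inv1 (\<epsilon> (stage_v2 S))"
    using C by (subst D(5)) (simp add: A.m_assoc)
  have "\<delta>' (inv1 (stage_v1 S)) \<star> y \<star> \<delta> (inv1 (\<epsilon> (stage_v2 S))) =
    stage_u2 S \<star> stage_v2 S \<star> inv2 (stage_v2 S)"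
    using D C by (simp add: c.hom_inv c'.hom_inv c.back_right)
  thus "stage_u2 S = \<delta>' (inv1 (stage_v1 S)) \<star> y \<star> \<delta> (inv1 (\<epsilon> (stage_v2 S)))"
    using C by (simp add: B.m_assoc)
qed

section \<open>The sequence of stages and its stabilisation\<close>

abbreviation seq :: "'a \<times> 'b \<Rightarrow> nat \<Rightarrow> ('a, 'b) stage" where
  "seq \<equiv> stage_seq W1 I1 W2 I2 (J1, J2, \<delta>) (J1', J2', \<delta>')"

abbreviation Jseq :: "'a \<times> 'b \<Rightarrow> nat \<Rightarrow> 'a set" where
  "Jseq p n \<equiv> stage_J1 (seq p n)"

text \<open>The pair that \<open>make_stage\<close> receives at stage n; for n > 0 it is formed from
  the data of stage n - 1.\<close>

primrec input :: "'a \<times> 'b \<Rightarrow> nat \<Rightarrow> 'a \<times> 'b" where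
  "input p 0 = p"
| "input p (Suc n) = (stage_u1 (seq p n) \<cdot> inv1 (\<epsilon> (stage_v2 (seq p n))), stage_u2 (seq p n))"

lemma seq_is_stage:
  assumes p: "p \<in> carrier W1 \<times> carrier W2"
  shows "is_stage (Jseq p n) (fst (input p n)) (snd (input p n)) (seq p n)"
proof (induction n)
  case 0
  have "is_stage J1 (fst p) (snd p) (seq p 0)"
    using is_stage_make_stage[of J1 "fst p" "snd p"] p by (auto simp del: make_stage.simps)
  thus ?case using stageD(2) by fastforce
next
  case (Suc n)
  have "is_stage (next_subset (stage_w2 (seq p n)) (stage_J2 (seq p n)))
      (fst (input p (Suc n))) (snd (input p (Suc n))) (seq p (Suc n))"
    using is_stage_next[OF Suc] by (simp del: next_stage.simps)
  thus ?case using stageD(2) by fastforce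
qed

lemma Jseq_Suc:
  assumes p: "p \<in> carrier W1 \<times> carrier W2"
  shows "Jseq p (Suc n) = next_subset (stage_w2 (seq p n)) (stage_J2 (seq p n))"
  using stageD(2)[OF is_stage_next[OF seq_is_stage[OF p, of n]]] by (simp del: next_stage.simps)

lemma Jseq_0: "p \<in> carrier W1 \<times> carrier W2 \<Longrightarrow> Jseq p 0 = J1"
  using stageD(2)[OF is_stage_make_stage[of J1 "fst p" "snd p"]] by (auto simp del: make_stage.simps)

lemma seq_step:
  assumes p: "p \<in> carrier W1 \<times> carrier W2"
  shows "\<epsilon> (stage_v2 (seq p n)) \<in> A.gen (Jseq p n)" "Jseq p (Suc n) \<subseteq> Jseq p n"
proof -
  have "\<epsilon> (stage_v2 (seq p n)) \<in> A.gen (Jseq p n) \<and> Jseq p (Suc n) \<subseteq> Jseq p n"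
  proof (induction n)
    case 0
    \<comment> \<open>The first set is all of \<open>J1\<close>, so both claims hold at the start
      for trivial reasons.\<close>
    show ?case unfolding Jseq_Suc[OF p] Jseq_0[OF p]
      using next_subset_subset stage_carrier(12)[OF seq_is_stage[OF p]] by blast
  next
    case (Suc n)
    have "is_stage (next_subset (stage_w2 (seq p n)) (stage_J2 (seq p n)))
      (stage_u1 (seq p n) \<cdot> inv1 (\<epsilon> (stage_v2 (seq p n)))) (stage_u2 (seq p n)) (seq p (Suc n))"
      using seq_is_stage[OF p, of "Suc n"] unfolding Jseq_Suc[OF p] input.simps fst_conv snd_conv .
    from stage_step(1,2)[OF seq_is_stage[OF p] conjunct1[OF Suc] _ this] show ?case
      using Suc unfolding Jseq_Suc[OF p] by blast
  qed
  thus "\<epsilon> (stage_v2 (seq p n)) \<in> A.gen (Jseq p n)" "Jseq p (Suc n) \<subseteq> Jseq p n" by blast+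
qed

lemma seq_cosets:
  assumes p: "p \<in> carrier W1 \<times> carrier W2"
  shows "\<exists>t\<in>A.gen (Jseq p n). stage_w1 (seq p (Suc n)) = stage_w1 (seq p n) \<cdot> t"
    "\<exists>t\<in>B.gen (stage_J2 (seq p n)). stage_w2 (seq p (Suc n)) = t \<star> stage_w2 (seq p n)"
proof -
  have *: "is_stage (next_subset (stage_w2 (seq p n)) (stage_J2 (seq p n)))
      (stage_u1 (seq p n) \<cdot> inv1 (\<epsilon> (stage_v2 (seq p n)))) (stage_u2 (seq p n)) (seq p (Suc n))"
    using seq_is_stage[OF p, of "Suc n"] unfolding Jseq_Suc[OF p] input.simps fst_conv snd_conv .
  show "\<exists>t\<in>A.gen (Jseq p n). stage_w1 (seq p (Suc n)) = stage_w1 (seq p n) \<cdot> t"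
    "\<exists>t\<in>B.gen (stage_J2 (seq p n)). stage_w2 (seq p (Suc n)) = t \<star> stage_w2 (seq p n)"
    using stage_step(3,4)[OF seq_is_stage[OF p] seq_step(1)[OF p] _ *] seq_step(2)[OF p]
    unfolding Jseq_Suc[OF p] by blast+
qed

lemma input_linked:
  assumes p: "p \<in> carrier W1 \<times> carrier W2"
  shows "linked p (input p n)"
proof (induction n)
  case 0 show ?case using linked_refl[OF p] by simp
next
  case (Suc n)
  have "linked (input p n) (input p (Suc n))"
    using stage_linked[OF seq_is_stage[OF p, of n]] by simp
  thus ?case using linked_trans[OF p Suc] by blast
qed

text \<open>The decreasing finite sets are constant from an index of least cardinality on, hence
  balanced. Consecutive values of \<open>stage_w1\<close> and \<open>stage_w2\<close> then lie in
  cosets with a unique minimal element, so they agree too.\<close>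

lemma seq_stable:
  assumes p: "p \<in> carrier W1 \<times> carrier W2"
  obtains N d e where "\<forall>n\<ge>N. stage_w1 (seq p n) = d" "\<forall>n\<ge>N. stage_w2 (seq p n) = e"
    "balanced d e (Jseq p N)" "stage_J2 (seq p N) = \<delta>' ` conj_set W1 d (Jseq p N)"
    "d \<in> A.left_reps J1'" "e \<in> B.right_reps J2"
proof -
  have dec: "Jseq p n \<subseteq> Jseq p m" if "m \<le> n" for m n
    using that by (induction n rule: dec_induct) (use seq_step(2)[OF p] in blast)+
  obtain N where N: "\<And>n. card (Jseq p N) \<le> card (Jseq p n)"
    using ex_has_least_nat[of "\<lambda>_. True" 0 "\<lambda>n. card (Jseq p n)"] by blast
  have fin: "finite (Jseq p n)" for n
    using stage_carrier(1)[OF seq_is_stage[OF p, of n]] A.finite_generators finite_subset by blast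
  have const: "Jseq p n = Jseq p N" if "n \<ge> N" for n
    using card_seteq[OF fin dec[OF that] N] .
  have bal: "balanced (stage_w1 (seq p n)) (stage_w2 (seq p n)) (Jseq p N)"
    "stage_J2 (seq p n) = \<delta>' ` conj_set W1 (stage_w1 (seq p n)) (Jseq p N)" if "n \<ge> N" for n
    using balanced_stage[OF seq_is_stage[OF p, of n]] Jseq_Suc[OF p, of n] const[of n] const[of "Suc n"] that
    by simp_all
  have reps: "stage_w1 (seq p n) \<in> A.left_reps J1'" "stage_w2 (seq p n) \<in> B.right_reps J2" for n
    using stageD(6,14)[OF seq_is_stage[OF p, of n]] .
  have step: "stage_w1 (seq p (Suc n)) = stage_w1 (seq p n) \<and> stage_w2 (seq p (Suc n)) = stage_w2 (seq p n)"
    if n: "n \<ge> N" for n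
  proof
    show "stage_w1 (seq p (Suc n)) = stage_w1 (seq p n)"
      using seq_cosets(1)[OF p, of n] balanced_left_unique[OF bal(1)[OF n] reps(1)] reps(1)[of "Suc n"]
      unfolding const[OF n] by metis
    have J2: "stage_J2 (seq p n) = conj_set W2 (stage_w2 (seq p n)) (\<delta> ` Jseq p N)"
      using bal[OF n] unfolding balanced_def by simp
    show "stage_w2 (seq p (Suc n)) = stage_w2 (seq p n)"
      using seq_cosets(2)[OF p, of n] balanced_right_unique[OF bal(1)[OF n] reps(2)] reps(2)[of "Suc n"]
      unfolding J2 by metis
  qed
  have "stage_w1 (seq p n) = stage_w1 (seq p N) \<and> stage_w2 (seq p n) = stage_w2 (seq p N)"
    if "n \<ge> N" for n
    using that by (induction n rule: dec_induct) (metis step)+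
  thus ?thesis using that[of N "stage_w1 (seq p N)" "stage_w2 (seq p N)"] bal[of N] reps[of N] by blast
qed

lemma stable_value_eqI:
  assumes "\<forall>n\<ge>N. stage_w1 (seq p n) = d" "\<forall>n\<ge>N. stage_w2 (seq p n) = e"
  shows "stable_value W1 I1 W2 I2 (J1, J2, \<delta>) (J1', J2', \<delta>') p = (d, e)"
  unfolding stable_value_def
proof (rule the_equality)
  show "\<exists>N. \<forall>n\<ge>N. (stage_w1 (seq p n), stage_w2 (seq p n)) = (d, e)" using assms by blast
  fix q assume "\<exists>N. \<forall>n\<ge>N. (stage_w1 (seq p n), stage_w2 (seq p n)) = q"
  then obtain M where "\<forall>n\<ge>M. (stage_w1 (seq p n), stage_w2 (seq p n)) = q" by blast
  thus "q = (d, e)" using assms by (metis max.cobounded1 max.cobounded2)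
qed

section \<open>The recursion on pairs linked to a base point\<close>

context
  fixes w1 w2 L
  assumes bal: "balanced w1 w2 L" and w1: "w1 \<in> A.left_reps J1'" and w2: "w2 \<in> B.right_reps J2"
begin

lemma wcarrier: "w1 \<in> carrier W1" "w2 \<in> carrier W2"
  using w1 w2 A.left_reps_closed B.right_reps_closed by blast+

text \<open>The induction step for the converse. The invariant says that the input is linked to the
  base point by some \<open>a\<close> and \<open>q\<close> with \<open>q\<close> confined to the
  current W_J; cancelling the known factors leaves equations to which the factorisation lemmas apply
  in \<open>W1\<close> and then in \<open>W2\<close>.\<close>

lemma linked_stage:
  fixes S :: "('a, 'b) stage"
  defines "Jn \<equiv> next_subset (stage_w2 S) (stage_J2 S)"
  assumes S: "is_stage J x y S" and L: "L \<subseteq> J" and z: "z \<in> A.gen L"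
    and a: "a \<in> A.gen J1'" and q: "q \<in> A.gen J"
    and x: "x = a \<cdot> (w1 \<cdot> z) \<cdot> q" and y: "y = \<delta>' a \<star> w2 \<star> \<delta> q"
  shows "\<exists>t\<in>A.gen J. w1 = stage_w1 S \<cdot> t" "\<exists>t\<in>B.gen (stage_J2 S). w2 = t \<star> stage_w2 S"
    "L \<subseteq> Jn"
    "\<exists>a'\<in>A.gen J1'. \<exists>q'\<in>A.gen Jn. stage_u1 S \<cdot> inv1 (\<epsilon> (stage_v2 S)) = a' \<cdot> (w1 \<cdot> z) \<cdot> q' \<and>
       stage_u2 S = \<delta>' a' \<star> w2 \<star> \<delta> q'"
proof -
  note D = stageD[OF S] and C = stage_carrier[OF S]
  have zJ: "z \<in> A.gen J" using z L A.gen_mono by blast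
  have qJ1: "q \<in> A.gen J1" using q D(1) A.gen_mono by blast
  obtain t0 where t0: "t0 \<in> A.gen J" "stage_u1 S = stage_w1 S \<cdot> t0" using D(8) by blast
  have c: "a \<in> carrier W1" "q \<in> carrier W1" "z \<in> carrier W1" "t0 \<in> carrier W1"
      "\<delta>' a \<in> carrier W2" "\<delta> q \<in> carrier W2" "w1 \<in> carrier W1" "w2 \<in> carrier W2"
    using a qJ1 zJ t0 C(1) A.gen_closed wcarrier c'.carrier_dom c'.carrier_ran c.carrier_dom c.carrier_ran
    by blast+
  have vu: "stage_v1 S \<cdot> stage_u1 S = a \<cdot> (w1 \<cdot> z) \<cdot> q" using D(5) x by simp
  \<comment> \<open>Chosen so that \<open>stage_w1 S\<close> times \<open>?t\<close> is an element
    of the group of \<open>J1'\<close> times \<open>w1\<close>, with \<open>w1\<close> as the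
    minimal factor.\<close>
  let ?t = "t0 \<cdot> inv1 q \<cdot> inv1 z"
  have tJ: "?t \<in> A.gen J" using t0 q zJ C(1) by (intro A.gen_mult A.gen_inv)
  have b: "inv1 (stage_v1 S) \<cdot> a \<in> A.gen J1'" using a D(4) c'.J1 by (intro A.gen_mult A.gen_inv)
  have "stage_u1 S = inv1 (stage_v1 S) \<cdot> (stage_v1 S \<cdot> stage_u1 S)" using C by simp
  hence u1: "stage_u1 S = inv1 (stage_v1 S) \<cdot> a \<cdot> w1 \<cdot> z \<cdot> q"
    unfolding vu using c C by (simp add: A.m_assoc)
  have "stage_w1 S \<cdot> ?t = stage_u1 S \<cdot> inv1 q \<cdot> inv1 z"
    using t0 c C by (simp add: A.m_assoc)
  also have "\<dots> = (inv1 (stage_v1 S) \<cdot> a) \<cdot> w1" unfolding u1 using c C by (simp add: A.m_assoc)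
  finally have wt: "stage_w1 S \<cdot> ?t = (inv1 (stage_v1 S) \<cdot> a) \<cdot> w1" .
  note L1 = A.left_factor_parabolic[OF c'.J1 C(1) D(6,7) tJ b w1 wt]
  from L1(2) show "\<exists>t\<in>A.gen J. w1 = stage_w1 S \<cdot> t" .
  then obtain t where t: "t \<in> A.gen J" "w1 = stage_w1 S \<cdot> t" by blast

  let ?b = "inv1 a \<cdot> stage_v1 S"
  have bJ: "?b \<in> A.gen J1'" using a D(4) c'.J1 by (intro A.gen_mult A.gen_inv)
  have "inv1 (inv1 (stage_v1 S) \<cdot> a) = ?b" using c C by (simp add: A.inv_mult_group)
  moreover have "conj_set W1 (stage_w1 S) J \<inter> J1' \<subseteq> I1" using c'.J1 by blast
  ultimately have "?b \<in> A.gen (conj_set W1 (stage_w1 S) J \<inter> J1')"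
    using A.gen_inv L1(1) by metis
  hence db: "\<delta>' ?b \<in> B.gen (stage_J2 S)" using left_image_gen[OF S] by blast
  have db_eq: "\<delta>' ?b = inv2 (\<delta>' a) \<star> \<delta>' (stage_v1 S)"
    using a D(4) c'.J1 A.gen_inv by (simp add: c'.hom_mult c'.hom_inv)
  have dbc: "\<delta>' ?b \<in> carrier W2" using bJ c'.carrier_ran by blast
  \<comment> \<open>\<open>?e\<close> measures how far \<open>stage_v2 S\<close> is from \<delta> q.
    The new linking pair consists of the inverses of \<open>?b\<close> and
    \<open>\<epsilon> ?e\<close>.\<close>
  let ?e = "stage_v2 S \<star> inv2 (\<delta> q)"
  have eJ: "?e \<in> B.gen J2" using D(11) c.closed[OF qJ1] c.J2 by (intro B.gen_mult B.gen_inv)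
  have ec: "?e \<in> carrier W2" using C c by simp
  have "stage_u2 S \<star> ?e = (stage_u2 S \<star> stage_v2 S) \<star> inv2 (\<delta> q)" using C c by (simp add: B.m_assoc)
  also have "\<dots> = inv2 (\<delta>' ?b) \<star> w2"
    unfolding D(12)[symmetric] y db_eq using C c by (simp add: B.m_assoc B.inv_mult_group)
  finally have ue: "stage_u2 S \<star> ?e = inv2 (\<delta>' ?b) \<star> w2" .
  obtain s0 where s0: "s0 \<in> B.gen (stage_J2 S)" "stage_u2 S = s0 \<star> stage_w2 S" using D(15) by blast
  have s0c: "s0 \<in> carrier W2" using s0 C(3) B.gen_closed by blast
  have sK: "\<delta>' ?b \<star> s0 \<in> B.gen (stage_J2 S)" using db s0 by (intro B.gen_mult)
  have eJ': "inv2 ?e \<in> B.gen J2" using eJ c.J2 B.gen_inv by blast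
  have "(\<delta>' ?b \<star> s0) \<star> stage_w2 S = \<delta>' ?b \<star> (stage_u2 S \<star> ?e) \<star> inv2 ?e"
    using s0 s0c dbc C ec by (simp add: B.m_assoc B.inv_mult_group)
  also have "\<dots> = w2 \<star> inv2 ?e" unfolding ue using dbc c ec by simp
  finally have "(\<delta>' ?b \<star> s0) \<star> stage_w2 S = w2 \<star> inv2 ?e" .
  note R1 = B.right_factor_parabolic[OF C(3) c.J2 D(13,14) sK eJ' w2 this]
  from R1(2) show "\<exists>t\<in>B.gen (stage_J2 S). w2 = t \<star> stage_w2 S" .
  then obtain s where s: "s \<in> B.gen (stage_J2 S)" "w2 = s \<star> stage_w2 S" by blast
  have "conj_set W2 (inv2 (stage_w2 S)) (stage_J2 S) \<inter> J2 \<subseteq> I2" using c.J2 by blast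
  hence "?e \<in> B.gen (conj_set W2 (inv2 (stage_w2 S)) (stage_J2 S) \<inter> J2)"
    using B.gen_inv[OF _ R1(1)] B.inv_inv[OF ec] by simp
  hence eJn: "\<epsilon> ?e \<in> A.gen Jn" unfolding Jn_def by (rule right_image_gen[OF S])
  have JnI: "Jn \<subseteq> I1" "Jn \<subseteq> J1" using next_subset_subset c.J1 unfolding Jn_def by blast+
  have eeJ1: "\<epsilon> ?e \<in> A.gen J1" using eJ c.back_closed by blast
  have eec: "\<epsilon> ?e \<in> carrier W1" using eJ c.carrier_back by blast
  have "stage_v2 S = ?e \<star> \<delta> q" using C c by (simp add: B.m_assoc)
  hence v2: "\<epsilon> (stage_v2 S) = \<epsilon> ?e \<cdot> q"
    using c.back_mult[OF eJ c.closed[OF qJ1]] c.back_left[OF qJ1] by simp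
  show "\<exists>a'\<in>A.gen J1'. \<exists>q'\<in>A.gen Jn. stage_u1 S \<cdot> inv1 (\<epsilon> (stage_v2 S)) = a' \<cdot> (w1 \<cdot> z) \<cdot> q' \<and>
       stage_u2 S = \<delta>' a' \<star> w2 \<star> \<delta> q'"
  proof (intro bexI conjI)
    show "inv1 ?b \<in> A.gen J1'" using bJ c'.J1 A.gen_inv by blast
    show "inv1 (\<epsilon> ?e) \<in> A.gen Jn" using eJn JnI A.gen_inv by blast
    show "stage_u1 S \<cdot> inv1 (\<epsilon> (stage_v2 S)) = inv1 ?b \<cdot> (w1 \<cdot> z) \<cdot> inv1 (\<epsilon> ?e)"
      unfolding u1 v2 using c C eec by (simp add: A.m_assoc A.inv_mult_group)
    have "\<delta>' (inv1 ?b) \<star> w2 \<star> \<delta> (inv1 (\<epsilon> ?e)) = inv2 (\<delta>' ?b) \<star> w2 \<star> inv2 ?e"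
      using c'.hom_inv[OF bJ] c.hom_inv[OF eeJ1] c.back_right[OF eJ] by simp
    also have "\<dots> = stage_u2 S" unfolding ue[symmetric] using C ec by (simp add: B.m_assoc B.inv_mult_group)
    finally show "stage_u2 S = \<delta>' (inv1 ?b) \<star> w2 \<star> \<delta> (inv1 (\<epsilon> ?e))" by simp
  qed
  have bL: "L \<subseteq> J1" "conj_set W1 w1 L \<subseteq> J1'" "\<delta>' ` conj_set W1 w1 L = conj_set W2 w2 (\<delta> ` L)"
    using bal unfolding balanced_def by auto
  \<comment> \<open>The inclusion of \<open>L\<close> in \<open>J\<close> survives both conjugations
    by monotonicity; balancedness identifies what has been carried to \<open>W2\<close> with the
    conjugate of the image of \<open>L\<close> under \<delta>.\<close>
  have "conj_set W1 w1 L \<inter> J1' \<subseteq> conj_set W1 (stage_w1 S) J \<inter> J1'"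
    using A.conj_set_Int_mono[OF c'.J1 C(1) D(6,7) t(1) L] t(2) by simp
  hence K: "\<delta>' ` conj_set W1 w1 L \<subseteq> stage_J2 S" unfolding D(9) using bL(2) by blast
  have dL: "\<delta> ` L \<subseteq> J2" "\<delta> ` L \<subseteq> carrier W2"
    using balanced_images[OF bal] B.generators_closed by blast+
  have "\<delta> ` L = conj_set W2 (inv2 w2) (\<delta>' ` conj_set W1 w1 L)"
    unfolding bL(3) using B.conj_set_inv_conj_set(1)[OF dL(2) c(8)] by simp
  also have "\<dots> \<inter> J2 \<subseteq> conj_set W2 (inv2 (stage_w2 S)) (stage_J2 S) \<inter> J2"
    using B.conj_set_inv_Int_mono[OF C(3) c.J2 D(13,14) s(1) K] s(2) by simp
  finally have "\<delta> ` L \<subseteq> conj_set W2 (inv2 (stage_w2 S)) (stage_J2 S) \<inter> J2" using dL(1) by blast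
  hence "\<epsilon> ` \<delta> ` L \<subseteq> Jn" unfolding Jn_def next_subset_def by (rule image_mono)
  thus "L \<subseteq> Jn" using c.back_image[OF bL(1)] by simp
qed

lemma linked_input:
  assumes p: "p \<in> carrier W1 \<times> carrier W2" and z: "z \<in> A.gen L" and l: "linked (w1 \<cdot> z, w2) p"
  shows "L \<subseteq> Jseq p n \<and> (\<exists>a\<in>A.gen J1'. \<exists>q\<in>A.gen (Jseq p n).
    fst (input p n) = a \<cdot> (w1 \<cdot> z) \<cdot> q \<and> snd (input p n) = \<delta>' a \<star> w2 \<star> \<delta> q)"
proof (induction n)
  case 0
  \<comment> \<open>Stage 0 works with all of \<open>J1\<close>, so the invariant is the definition
    of \<open>linked\<close>.\<close>
  show ?case using l bal unfolding Jseq_0[OF p] input.simps linked_def balanced_def by simp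
next
  case (Suc n)
  then obtain a q where *: "L \<subseteq> Jseq p n" "a \<in> A.gen J1'" "q \<in> A.gen (Jseq p n)"
    "fst (input p n) = a \<cdot> (w1 \<cdot> z) \<cdot> q" "snd (input p n) = \<delta>' a \<star> w2 \<star> \<delta> q" by blast
  show ?case unfolding Jseq_Suc[OF p] input.simps fst_conv snd_conv
    using linked_stage(3,4)[OF seq_is_stage[OF p, of n] *(1) z *(2-5)] by blast
qed

lemma linked_seq:
  assumes p: "p \<in> carrier W1 \<times> carrier W2" and z: "z \<in> A.gen L" and l: "linked (w1 \<cdot> z, w2) p"
  shows "L \<subseteq> Jseq p n" "\<exists>t\<in>A.gen (Jseq p n). w1 = stage_w1 (seq p n) \<cdot> t"
    "\<exists>t\<in>B.gen (stage_J2 (seq p n)). w2 = t \<star> stage_w2 (seq p n)"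
proof -
  obtain a q where *: "L \<subseteq> Jseq p n" "a \<in> A.gen J1'" "q \<in> A.gen (Jseq p n)"
    "fst (input p n) = a \<cdot> (w1 \<cdot> z) \<cdot> q" "snd (input p n) = \<delta>' a \<star> w2 \<star> \<delta> q"
    using linked_input[OF assms, of n] by blast
  from linked_stage(1,2)[OF seq_is_stage[OF p, of n] *(1) z *(2-5)] *(1)
  show "L \<subseteq> Jseq p n" "\<exists>t\<in>A.gen (Jseq p n). w1 = stage_w1 (seq p n) \<cdot> t"
    "\<exists>t\<in>B.gen (stage_J2 (seq p n)). w2 = t \<star> stage_w2 (seq p n)" by blast+
qed

text \<open>At a stable stage \<open>w1\<close> and \<open>w2\<close> lie in the cosets of the
  eventual values \<open>d\<close> and \<open>e\<close>; minimality on both sides forces equality.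
  The final set is then balanced for \<open>w1\<close> and \<open>w2\<close> themselves.\<close>

lemma linked_stable:
  assumes p: "p \<in> carrier W1 \<times> carrier W2" and z: "z \<in> A.gen L" and l: "linked (w1 \<cdot> z, w2) p"
  shows "stable_value W1 I1 W2 I2 (J1, J2, \<delta>) (J1', J2', \<delta>') p = (w1, w2)"
    "\<exists>N. balanced w1 w2 (Jseq p N)"
proof -
  obtain N d e where N: "\<forall>n\<ge>N. stage_w1 (seq p n) = d" "\<forall>n\<ge>N. stage_w2 (seq p n) = e"
    and b: "balanced d e (Jseq p N)" "stage_J2 (seq p N) = \<delta>' ` conj_set W1 d (Jseq p N)"
    and reps: "d \<in> A.left_reps J1'" "e \<in> B.right_reps J2"
    using seq_stable[OF p] by blast
  have w1': "\<exists>t\<in>A.gen (Jseq p N). w1 = d \<cdot> t"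
    using linked_seq(2)[OF assms, of N] N(1) by (metis order.refl)
  have "stage_J2 (seq p N) = conj_set W2 e (\<delta> ` Jseq p N)"
    using b unfolding balanced_def by simp
  hence w2': "\<exists>t\<in>B.gen (conj_set W2 e (\<delta> ` Jseq p N)). w2 = t \<star> e"
    using linked_seq(3)[OF assms, of N] N(2) by (metis order.refl)
  have "w1 = d" using balanced_left_unique[OF b(1) reps(1)] w1 w1' by metis
  moreover have "w2 = e" using balanced_right_unique[OF b(1) reps(2)] w2 w2' by metis
  ultimately show "stable_value W1 I1 W2 I2 (J1, J2, \<delta>) (J1', J2', \<delta>') p = (w1, w2)"
    "\<exists>N. balanced w1 w2 (Jseq p N)"
    using stable_value_eqI[OF N] b(1) by blast+
qed

text \<open>From \<open>q\<close> in W_J the first equation places \<open>a\<close> in the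
  intersection of the group of \<open>J1'\<close> with a conjugate of W_J. Then \<delta>' a lies in
  the group of \<open>stage_J2 S\<close>, and the second equation places \<delta> q in the next
  intersection.\<close>

lemma stabilizer_stage:
  assumes S: "is_stage J x y S" and L: "L \<subseteq> J" and z: "z \<in> A.gen L" "z' \<in> A.gen L"
    and a: "a \<in> A.gen J1'" and q: "q \<in> A.gen J"
    and eq: "w1 \<cdot> z' = a \<cdot> (w1 \<cdot> z) \<cdot> q" "w2 = \<delta>' a \<star> w2 \<star> \<delta> q"
    and w1t: "\<exists>t\<in>A.gen J. w1 = stage_w1 S \<cdot> t"
    and w2t: "\<exists>t\<in>B.gen (stage_J2 S). w2 = t \<star> stage_w2 S"
  shows "q \<in> A.gen (next_subset (stage_w2 S) (stage_J2 S))"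
proof -
  note D = stageD[OF S] and C = stage_carrier[OF S]
  have zJ: "z \<in> A.gen J" "z' \<in> A.gen J" using z L A.gen_mono by blast+
  have qJ1: "q \<in> A.gen J1" using q D(1) A.gen_mono by blast
  obtain t where t: "t \<in> A.gen J" "w1 = stage_w1 S \<cdot> t" using w1t by blast
  obtain s where s: "s \<in> B.gen (stage_J2 S)" "w2 = s \<star> stage_w2 S" using w2t by blast
  have c: "a \<in> carrier W1" "q \<in> carrier W1" "z \<in> carrier W1" "z' \<in> carrier W1" "t \<in> carrier W1"
      "\<delta>' a \<in> carrier W2" "\<delta> q \<in> carrier W2" "s \<in> carrier W2"
    using c'.carrier_dom[OF a] c.carrier_dom[OF qJ1] A.gen_closed[OF C(1)] zJ t(1)
      c'.carrier_ran[OF a] c.carrier_ran[OF qJ1] B.gen_closed[OF C(3) s(1)] by simp_all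
  let ?t = "t \<cdot> z' \<cdot> inv1 q \<cdot> inv1 z \<cdot> inv1 t"
  have tJ: "?t \<in> A.gen J" using t zJ q C(1) by (intro A.gen_mult A.gen_inv)
  have "stage_w1 S \<cdot> ?t = (w1 \<cdot> z') \<cdot> inv1 q \<cdot> inv1 z \<cdot> inv1 t"
    using t c C by (simp add: A.m_assoc)
  also have "\<dots> = a \<cdot> stage_w1 S" unfolding eq(1) unfolding t(2) using c C by (simp add: A.m_assoc)
  finally have "stage_w1 S \<cdot> ?t = a \<cdot> stage_w1 S" .
  from A.parabolic_conj_Int[OF c'.J1 C(1) D(6,7) tJ a this]
  have da: "\<delta>' a \<in> B.gen (stage_J2 S)" by (rule left_image_gen[OF S])
  let ?s = "inv2 s \<star> inv2 (\<delta>' a) \<star> s"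
  have sK: "?s \<in> B.gen (stage_J2 S)" using s da C(3) by (intro B.gen_mult B.gen_inv)
  have "?s \<star> stage_w2 S = inv2 s \<star> inv2 (\<delta>' a) \<star> w2" using s c C by (simp add: B.m_assoc)
  also have "\<dots> = inv2 s \<star> inv2 (\<delta>' a) \<star> (\<delta>' a \<star> w2 \<star> \<delta> q)" using eq(2) by simp
  also have "\<dots> = stage_w2 S \<star> \<delta> q" unfolding s(2) using c C by (simp add: B.m_assoc)
  finally have "?s \<star> stage_w2 S = stage_w2 S \<star> \<delta> q" .
  from B.right_factor_parabolic(1)[OF C(3) c.J2 D(13,14) sK c.closed[OF qJ1] D(14) this]
  have "\<epsilon> (\<delta> q) \<in> A.gen (next_subset (stage_w2 S) (stage_J2 S))" by (rule right_image_gen[OF S])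
  thus ?thesis using c.back_left[OF qJ1] by simp
qed

text \<open>The recursion is run on the base point (w1 z, w2) itself. The element \<open>q\<close>
  stays in every group of the sequence, hence in the final one, whose generating set is balanced for
  \<open>w1\<close> and \<open>w2\<close>.\<close>

lemma stabilizer_largest:
  assumes z: "z \<in> A.gen L" "z' \<in> A.gen L" and a: "a \<in> A.gen J1'" and q: "q \<in> A.gen J1"
    and eq: "w1 \<cdot> z' = a \<cdot> (w1 \<cdot> z) \<cdot> q" "w2 = \<delta>' a \<star> w2 \<star> \<delta> q"
  shows "q \<in> A.gen (largest w1 w2)"
proof -
  let ?p = "(w1 \<cdot> z, w2)"
  have "z \<in> carrier W1" using z A.gen_closed balanced_images(2)[OF bal] by blast
  hence p: "?p \<in> carrier W1 \<times> carrier W2" using wcarrier by simp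
  note P = p z(1) linked_refl[OF p]
  have *: "q \<in> A.gen (Jseq ?p n)" for n
  proof (induction n)
    case 0 show ?case using q unfolding Jseq_0[OF p] .
  next
    case (Suc n)
    show ?case unfolding Jseq_Suc[OF p]
      by (rule stabilizer_stage[OF seq_is_stage[OF p] linked_seq(1)[OF P] z a Suc eq linked_seq(2,3)[OF P]])
  qed
  obtain N where "balanced w1 w2 (Jseq ?p N)" using linked_stable(2)[OF P] ..
  from A.gen_mono[OF balanced_subset_largest[OF this] *] show ?thesis .
qed

end
end

section \<open>Fibres and twisted conjugacy classes\<close>

text \<open>\<open>f\<close> and \<open>g\<close> identify the same points, so \<open>f x\<close>
  determines \<open>g x\<close> and conversely. It is applied to twisted classes and double cosets,
  both indexed by the same subgroup.\<close>

lemma bij_betw_equal_images: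
  assumes eq: "\<And>x y. x \<in> A \<Longrightarrow> y \<in> A \<Longrightarrow> f x = f y \<longleftrightarrow> g x = g y"
  shows "\<exists>\<phi>. bij_betw \<phi> (f ` A) (g ` A) \<and> (\<forall>x\<in>A. \<phi> (f x) = g x)"
proof -
  let ?\<phi> = "g \<circ> inv_into A f"
  have *: "?\<phi> (f x) = g x" if "x \<in> A" for x
  proof -
    have "inv_into A f (f x) \<in> A" "f (inv_into A f (f x)) = f x"
      using that by (auto intro: inv_into_into f_inv_into_f)
    thus ?thesis using eq that by simp
  qed
  have "?\<phi> ` f ` A = g ` A" using * by (force simp: image_image)
  moreover have "inj_on ?\<phi> (f ` A)" using * eq by (auto intro!: inj_onI simp del: comp_apply)
  ultimately show ?thesis using * by (intro exI[of _ ?\<phi>]) (auto simp: bij_betw_def)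
qed

section \<open>The fibre as a union of double cosets of base points\<close>

context triple_pair
begin

abbreviation Wc where "Wc \<equiv> triple_graph W1 (J1, J2, \<delta>)"
abbreviation Wc' where "Wc' \<equiv> triple_graph W1 (J1', J2', \<delta>')"

lemma double_coset_eq_linked:
  "double_coset (W1 \<times>\<times> W2) Wc' p Wc = {q. linked p q}"
proof (cases p)
  case (Pair x y)
  show ?thesis unfolding Pair double_coset_def linked_def set_mult_def
    by (auto simp: mult_DirProd) blast+
qed

lemma set_mult_eq_linked:
  "Wc' <#>\<^bsub>W1 \<times>\<times> W2\<^esub> ((d <#\<^bsub>W1\<^esub> Z) \<times> {e}) <#>\<^bsub>W1 \<times>\<times> W2\<^esub> Wc = {q. \<exists>z\<in>Z. linked (d \<cdot> z, e) q}"
  unfolding linked_def set_mult_def l_coset_def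
  by (auto simp: mult_DirProd) blast+

context
  fixes w1 w2 H \<sigma> F
  assumes w1: "w1 \<in> A.left_reps J1'" and w2: "w2 \<in> B.right_reps J2"
  defines "H \<equiv> A.gen (largest w1 w2)"
    and "\<sigma> \<equiv> twist W1 W2 (J1, J2, \<delta>) (J1', J2', \<delta>') w1 w2"
    and "F \<equiv> fiber W1 I1 W2 I2 (J1, J2, \<delta>) (J1', J2', \<delta>') w1 w2"
begin

lemmas H_balanced = balanced_largest[of w1 w2]
lemmas w_carrier = wcarrier[OF H_balanced w1 w2]

lemma H_sub: "z \<in> H \<Longrightarrow> z \<in> A.gen J1" "z \<in> H \<Longrightarrow> z \<in> carrier W1"
  using balanced_images(1)[OF H_balanced] A.gen_mono c.carrier_dom unfolding H_def by blast+

lemma base_carrier: "z \<in> H \<Longrightarrow> (w1 \<cdot> z, w2) \<in> carrier W1 \<times> carrier W2"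
  using H_sub w_carrier by simp

text \<open>A point of the fibre reaches a stage with value (w1, w2), whose following input is w1
  times an element of the final parabolic subgroup, paired with s w2. The factor s is removed by an
  element of W_c' whose first coordinate is conjugated by w1^-1 into that subgroup. The other
  inclusion is \<open>linked_stable\<close>.\<close>

lemma fiber_eq_linked: "F = {q. \<exists>z\<in>H. linked (w1 \<cdot> z, w2) q}"
proof (intro subset_antisym subsetI)
  fix p assume "p \<in> F"
  hence p: "p \<in> carrier W1 \<times> carrier W2"
    and val: "stable_value W1 I1 W2 I2 (J1, J2, \<delta>) (J1', J2', \<delta>') p = (w1, w2)"
    by (auto simp: F_def fiber_def)
  obtain N d e where N: "\<forall>n\<ge>N. stage_w1 (seq p n) = d" "\<forall>n\<ge>N. stage_w2 (seq p n) = e"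
    and b: "balanced d e (Jseq p N)" "stage_J2 (seq p N) = \<delta>' ` conj_set W1 d (Jseq p N)"
    and "d \<in> A.left_reps J1'" "e \<in> B.right_reps J2"
    by (rule seq_stable[OF p])
  have de: "d = w1" "e = w2" using stable_value_eqI[OF N] val by simp_all
  note b = b[unfolded de]
  let ?J = "Jseq p N"
  have w: "stage_w1 (seq p N) = w1" "stage_w2 (seq p N) = w2" using N de by blast+
  note S = seq_is_stage[OF p, of N]
  note D = stageD[OF S] and C = stage_carrier[OF S]
  let ?v = "\<epsilon> (stage_v2 (seq p N))"
  obtain t where t: "t \<in> A.gen ?J" "stage_u1 (seq p N) = w1 \<cdot> t" using D(8) w by metis
  obtain s where s: "s \<in> B.gen (stage_J2 (seq p N))" "stage_u2 (seq p N) = s \<star> w2"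
    using D(15) w by metis
  have X: "conj_set W1 w1 ?J \<subseteq> J1'" using b(1) unfolding balanced_def by blast
  have sJ2': "stage_J2 (seq p N) \<subseteq> J2'" "c'.\<epsilon> ` stage_J2 (seq p N) = conj_set W1 w1 ?J"
    using C(2) c'.back_image[OF X] unfolding b(2) .
  let ?a = "c'.\<epsilon> s"
  have aX: "?a \<in> A.gen (conj_set W1 w1 ?J)" using c'.back_gen_image[OF sJ2'(1) s(1)] sJ2'(2) by simp
  have sG: "s \<in> B.gen J2'" using s sJ2' B.gen_mono by blast
  have a: "?a \<in> A.gen J1'" "\<delta>' ?a = s" using c'.back_closed[OF sG] c'.back_right[OF sG] .
  have XI: "conj_set W1 w1 ?J \<subseteq> I1" using X c'.J1 by blast
  \<comment> \<open>Solves u1 v^-1 = a (w1 z) for z; translation by \<open>?a\<close> on the left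
    then links the base point to the next input.\<close>
  let ?z = "(inv1 w1 \<cdot> inv1 ?a \<cdot> w1) \<cdot> t \<cdot> inv1 ?v"
  have "inv1 w1 \<cdot> inv1 ?a \<cdot> w1 \<in> A.gen ?J"
    using balanced_inv_conj[OF b(1) w_carrier(1) A.gen_inv[OF XI aX]] .
  hence "?z \<in> A.gen ?J"
    using A.gen_mult A.gen_inv[OF C(1) seq_step(1)[OF p, of N]] t(1) by metis
  hence zH: "?z \<in> H" using balanced_subset_largest[OF b(1)] A.gen_mono unfolding H_def by blast
  have c: "?a \<in> carrier W1" "s \<in> carrier W2" "t \<in> carrier W1" "?v \<in> carrier W1"
    using c'.carrier_dom[OF a(1)] c'.carrier_ran[OF a(1)] a(2) A.gen_closed[OF C(1) t(1)] C(11)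
    by simp_all
  have "linked (w1 \<cdot> ?z, w2) (input p (Suc N))"
    unfolding input.simps
  proof (rule linkedI)
    show "stage_u1 (seq p N) \<cdot> inv1 ?v = ?a \<cdot> (w1 \<cdot> ?z) \<cdot> \<one>\<^bsub>W1\<^esub>"
      unfolding t(2) using c w_carrier by (simp add: A.m_assoc)
    show "stage_u2 (seq p N) = \<delta>' ?a \<star> w2 \<star> \<delta> \<one>\<^bsub>W1\<^esub>"
      unfolding s(2) a(2) using c w_carrier by simp
  qed (use a generate.one in blast)+
  moreover have "linked (input p (Suc N)) p"
    using linked_sym[OF p input_linked[OF p]] .
  ultimately have "linked (w1 \<cdot> ?z, w2) p" using linked_trans[OF base_carrier[OF zH]] by blast
  thus "p \<in> {q. \<exists>z\<in>H. linked (w1 \<cdot> z, w2) q}" using zH by blast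
next
  fix p assume "p \<in> {q. \<exists>z\<in>H. linked (w1 \<cdot> z, w2) q}"
  then obtain z where z: "z \<in> H" "linked (w1 \<cdot> z, w2) p" by blast
  have p: "p \<in> carrier W1 \<times> carrier W2" using linked_carrier[OF z(2) base_carrier[OF z(1)]] .
  from linked_stable(1)[OF H_balanced w1 w2 p z[unfolded H_def]] p
  show "p \<in> F" unfolding F_def fiber_def by simp
qed

section \<open>The twisting automorphism of the stable parabolic subgroup\<close>

lemma twist_eq: "\<sigma> w = \<epsilon> (inv2 w2 \<star> \<delta>' (w1 \<cdot> w \<cdot> inv1 w1) \<star> w2)"
  by (simp add: \<sigma>_def)

text \<open>Balancedness makes the conjugations by \<open>w1\<close> and \<open>w2\<close> fit
  together, so the \<open>inv_into\<close> inside \<open>twist\<close> is only applied to elements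
  of W_J2, where it inverts \<delta>.\<close>

lemma conj_H:
  assumes "w \<in> H"
  shows "w1 \<cdot> w \<cdot> inv1 w1 \<in> A.gen J1'" "\<delta>' (w1 \<cdot> w \<cdot> inv1 w1) \<in> carrier W2"
    "inv2 w2 \<star> \<delta>' (w1 \<cdot> w \<cdot> inv1 w1) \<star> w2 \<in> B.gen (\<delta> ` largest w1 w2)"
    "inv2 w2 \<star> \<delta>' (w1 \<cdot> w \<cdot> inv1 w1) \<star> w2 \<in> B.gen J2"
proof -
  note C = balanced_conj[OF H_balanced w_carrier(1) assms[unfolded H_def]]
  show "w1 \<cdot> w \<cdot> inv1 w1 \<in> A.gen J1'" "\<delta>' (w1 \<cdot> w \<cdot> inv1 w1) \<in> carrier W2"
    using C(2) c'.carrier_ran by blast+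
  have "\<delta>' (w1 \<cdot> w \<cdot> inv1 w1) \<in> B.gen (conj_set W2 w2 (\<delta> ` largest w1 w2))"
    using c'.gen_image[OF balanced_images(7)[OF H_balanced] C(1)] H_balanced
    unfolding balanced_def by simp
  from balanced_right_conj[OF H_balanced w_carrier(2) this]
  show "inv2 w2 \<star> \<delta>' (w1 \<cdot> w \<cdot> inv1 w1) \<star> w2 \<in> B.gen (\<delta> ` largest w1 w2)"
    "inv2 w2 \<star> \<delta>' (w1 \<cdot> w \<cdot> inv1 w1) \<star> w2 \<in> B.gen J2"
    using balanced_images(3)[OF H_balanced] B.gen_mono by blast+
qed

lemma twist_closed: "w \<in> H \<Longrightarrow> \<sigma> w \<in> H"
  using c.back_gen_image[OF balanced_images(3)[OF H_balanced] conj_H(3)]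
    c.back_image[OF balanced_images(1)[OF H_balanced]]
  unfolding twist_eq H_def by simp

lemma delta_twist: "w \<in> H \<Longrightarrow> \<delta> (\<sigma> w) = inv2 w2 \<star> \<delta>' (w1 \<cdot> w \<cdot> inv1 w1) \<star> w2"
  unfolding twist_eq using c.back_right conj_H(4) by blast

lemma twist_mult:
  assumes "v \<in> H" "w \<in> H" shows "\<sigma> (v \<cdot> w) = \<sigma> v \<cdot> \<sigma> w"
proof -
  have "\<delta>' (w1 \<cdot> (v \<cdot> w) \<cdot> inv1 w1) = \<delta>' ((w1 \<cdot> v \<cdot> inv1 w1) \<cdot> (w1 \<cdot> w \<cdot> inv1 w1))"
    using assms H_sub w_carrier by (simp add: A.m_assoc)
  also have "\<dots> = \<delta>' (w1 \<cdot> v \<cdot> inv1 w1) \<star> \<delta>' (w1 \<cdot> w \<cdot> inv1 w1)"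
    using c'.hom_mult conj_H(1) assms by blast
  finally have "inv2 w2 \<star> \<delta>' (w1 \<cdot> (v \<cdot> w) \<cdot> inv1 w1) \<star> w2 =
    (inv2 w2 \<star> \<delta>' (w1 \<cdot> v \<cdot> inv1 w1) \<star> w2) \<star> (inv2 w2 \<star> \<delta>' (w1 \<cdot> w \<cdot> inv1 w1) \<star> w2)"
    using assms conj_H(2) w_carrier by (simp add: B.m_assoc)
  thus ?thesis unfolding twist_eq using c.back_mult conj_H(4) assms by simp
qed

lemma twist_inj:
  assumes "v \<in> H" "w \<in> H" "\<sigma> v = \<sigma> w" shows "v = w"
proof -
  have "inv2 w2 \<star> \<delta>' (w1 \<cdot> v \<cdot> inv1 w1) \<star> w2 = inv2 w2 \<star> \<delta>' (w1 \<cdot> w \<cdot> inv1 w1) \<star> w2"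
    using assms delta_twist by metis
  hence "\<delta>' (w1 \<cdot> v \<cdot> inv1 w1) = \<delta>' (w1 \<cdot> w \<cdot> inv1 w1)"
    using assms conj_H(2) w_carrier by simp
  hence "w1 \<cdot> v \<cdot> inv1 w1 = w1 \<cdot> w \<cdot> inv1 w1"
    using c'.bij conj_H(1) assms by (auto simp: bij_betw_def dest: inj_onD)
  thus ?thesis using assms H_sub w_carrier by simp
qed

text \<open>The maps that compose \<open>twist\<close> are inverted one after the other, and
  balancedness keeps each intermediate element in the required parabolic subgroup.\<close>

lemma twist_surj:
  assumes "h \<in> H" shows "\<exists>w\<in>H. \<sigma> w = h"
proof -
  have h: "h \<in> A.gen J1" using assms H_sub by blast
  have hc: "\<delta> h \<in> carrier W2" using h c.carrier_ran by blast
  have im: "\<delta> ` largest w1 w2 \<subseteq> carrier W2" "largest w1 w2 \<subseteq> carrier W1"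
    using balanced_images[OF H_balanced] A.generators_closed B.generators_closed by blast+
  have eq: "conj_set W2 w2 (\<delta> ` largest w1 w2) = \<delta>' ` conj_set W1 w1 (largest w1 w2)"
    using H_balanced unfolding balanced_def by simp
  have "\<delta> h \<in> B.gen (\<delta> ` largest w1 w2)"
    using c.gen_image[OF balanced_images(1)[OF H_balanced]] assms unfolding H_def by blast
  from B.conj_gen[OF im(1) w_carrier(2) this]
  have k: "w2 \<star> \<delta> h \<star> inv2 w2 \<in> B.gen (conj_set W2 w2 (\<delta> ` largest w1 w2))" (is "?k \<in> _") .
  hence kJ: "?k \<in> B.gen J2'" using balanced_images(5)[OF H_balanced] B.gen_mono by blast
  let ?g = "c'.\<epsilon> ?k"
  have g: "?g \<in> A.gen (conj_set W1 w1 (largest w1 w2))"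
    using c'.back_gen_image[OF balanced_images(5)[OF H_balanced] k]
      c'.back_image[OF balanced_images(7)[OF H_balanced]] unfolding eq by simp
  have gc: "?g \<in> carrier W1" using kJ c'.carrier_back by blast
  let ?w = "inv1 w1 \<cdot> ?g \<cdot> w1"
  have w: "?w \<in> H" unfolding H_def using balanced_inv_conj[OF H_balanced w_carrier(1) g] .
  have "w1 \<cdot> ?w \<cdot> inv1 w1 = ?g" using gc w_carrier by (simp add: A.m_assoc)
  hence "\<sigma> ?w = \<epsilon> (inv2 w2 \<star> ?k \<star> w2)" unfolding twist_eq using c'.back_right[OF kJ] by simp
  also have "inv2 w2 \<star> ?k \<star> w2 = \<delta> h" using hc w_carrier by (simp add: B.m_assoc)
  finally show ?thesis using w c.back_left[OF h] by auto
qed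

lemma twist_iso: "\<sigma> \<in> iso (W1\<lparr>carrier := H\<rparr>) (W1\<lparr>carrier := H\<rparr>)"
proof -
  have "bij_betw \<sigma> H H"
    unfolding bij_betw_def inj_on_def using twist_inj twist_closed twist_surj by blast
  thus ?thesis using twist_closed twist_mult by (auto simp: iso_def hom_def)
qed

text \<open>Twisted conjugation by g is the link given by w1 g w1^-1 on the left and the inverse of
  \<sigma> g on the right; the definition of \<sigma> makes it fix \<open>w2\<close>. Conversely
  \<open>stabilizer_largest\<close> puts the right factor of any link between base points into
  \<open>H\<close>, and the two coordinate equations recover g and \<sigma> g.\<close>

lemma orbit_eq_linked:
  assumes z: "z \<in> H"
  shows "orbit (W1\<lparr>carrier := H\<rparr>) (\<lambda>w w'. w \<cdot> w' \<cdot> inv\<^bsub>W1\<lparr>carrier := H\<rparr>\<^esub> (\<sigma> w)) z =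
    {z' \<in> H. linked (w1 \<cdot> z, w2) (w1 \<cdot> z', w2)}"
proof -
  have HI: "largest w1 w2 \<subseteq> I1" using balanced_images(2)[OF H_balanced] .
  have sub: "subgroup H W1" unfolding H_def using A.gen_subgroup[OF HI] .
  have i: "inv\<^bsub>W1\<lparr>carrier := H\<rparr>\<^esub> (\<sigma> w) = inv1 (\<sigma> w)" if "w \<in> H" for w
    using A.m_inv_consistent[OF sub twist_closed[OF that]] .
  have 1: "g \<cdot> z \<cdot> inv1 (\<sigma> g) \<in> H \<and> linked (w1 \<cdot> z, w2) (w1 \<cdot> (g \<cdot> z \<cdot> inv1 (\<sigma> g)), w2)"
    if g: "g \<in> H" for g
  proof
    have sg: "\<sigma> g \<in> H" using twist_closed g by blast
    show "g \<cdot> z \<cdot> inv1 (\<sigma> g) \<in> H"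
      using g z sg unfolding H_def by (intro A.gen_mult A.gen_inv HI)
    show "linked (w1 \<cdot> z, w2) (w1 \<cdot> (g \<cdot> z \<cdot> inv1 (\<sigma> g)), w2)"
    proof (rule linkedI)
      show "w1 \<cdot> g \<cdot> inv1 w1 \<in> A.gen J1'" using conj_H(1)[OF g] .
      show "inv1 (\<sigma> g) \<in> A.gen J1" using H_sub(1)[OF sg] A.gen_inv c.J1 by blast
      show "w1 \<cdot> (g \<cdot> z \<cdot> inv1 (\<sigma> g)) = w1 \<cdot> g \<cdot> inv1 w1 \<cdot> (w1 \<cdot> z) \<cdot> inv1 (\<sigma> g)"
        using g z sg H_sub w_carrier by (simp add: A.m_assoc)
      show "w2 = \<delta>' (w1 \<cdot> g \<cdot> inv1 w1) \<star> w2 \<star> \<delta> (inv1 (\<sigma> g))"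
        unfolding c.hom_inv[OF H_sub(1)[OF sg]] delta_twist[OF g] using conj_H(2)[OF g] w_carrier
        by (simp add: B.m_assoc B.inv_mult_group)
    qed
  qed
  have 2: "\<exists>g\<in>H. z' = g \<cdot> z \<cdot> inv1 (\<sigma> g)" if z': "z' \<in> H" and l: "linked (w1 \<cdot> z, w2) (w1 \<cdot> z', w2)" for z'
  proof -
    obtain a q where a: "a \<in> A.gen J1'" and q: "q \<in> A.gen J1"
      and eq: "w1 \<cdot> z' = a \<cdot> (w1 \<cdot> z) \<cdot> q" "w2 = \<delta>' a \<star> w2 \<star> \<delta> q"
      using l unfolding linked_def by auto
    have qH: "q \<in> H"
      using stabilizer_largest[OF H_balanced w1 w2 z[unfolded H_def] z'[unfolded H_def] a q eq]
      unfolding H_def .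
    have c: "a \<in> carrier W1" "q \<in> carrier W1" "z \<in> carrier W1" "z' \<in> carrier W1"
      "\<delta>' a \<in> carrier W2" "\<delta> q \<in> carrier W2"
      using c'.carrier_dom[OF a] c.carrier_dom[OF q] H_sub(2)[OF z] H_sub(2)[OF z']
        c'.carrier_ran[OF a] c.carrier_ran[OF q] .
    \<comment> \<open>Solves z' = g z q for g. Conjugating \<open>?g\<close> by \<open>w1\<close>
      gives \<open>a\<close>, after which the equation for \<open>w2\<close> says that \<sigma>
      sends \<open>?g\<close> to the inverse of \<open>q\<close>.\<close>
    let ?g = "z' \<cdot> inv1 q \<cdot> inv1 z"
    have g: "?g \<in> H" using qH z z' unfolding H_def by (intro A.gen_mult A.gen_inv HI)
    have "w1 \<cdot> ?g \<cdot> inv1 w1 = (w1 \<cdot> z') \<cdot> inv1 q \<cdot> inv1 z \<cdot> inv1 w1"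
      using c w_carrier by (simp add: A.m_assoc)
    also have "\<dots> = a" unfolding eq(1) using c w_carrier by (simp add: A.m_assoc)
    finally have "\<sigma> ?g = \<epsilon> (inv2 w2 \<star> \<delta>' a \<star> w2)" unfolding twist_eq by simp
    also have "inv2 w2 \<star> \<delta>' a \<star> w2 = \<delta> (inv1 q)"
    proof -
      have "inv2 w2 \<star> \<delta>' a \<star> w2 = inv2 w2 \<star> (\<delta>' a \<star> w2 \<star> \<delta> q) \<star> inv2 (\<delta> q)"
        using c w_carrier by (simp add: B.m_assoc)
      thus ?thesis using eq(2)[symmetric] c w_carrier c.hom_inv[OF q] by simp
    qed
    also have "\<epsilon> \<dots> = inv1 q" using c.back_left q A.gen_inv c.J1 by blast
    finally have "z' = ?g \<cdot> z \<cdot> inv1 (\<sigma> ?g)" using c by (simp add: A.m_assoc)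
    thus ?thesis using g by blast
  qed
  have "orbit (W1\<lparr>carrier := H\<rparr>) (\<lambda>w w'. w \<cdot> w' \<cdot> inv\<^bsub>W1\<lparr>carrier := H\<rparr>\<^esub> (\<sigma> w)) z =
      {g \<cdot> z \<cdot> inv1 (\<sigma> g) | g. g \<in> H}"
    unfolding orbit_def using i by force
  also have "\<dots> = {z' \<in> H. linked (w1 \<cdot> z, w2) (w1 \<cdot> z', w2)}" using 1 2 by blast
  finally show ?thesis .
qed

text \<open>Classes and double cosets are both families indexed by \<open>H\<close>, and in both
  families two indices give the same member exactly if their base points are linked.\<close>

lemma twisted_classes_bij:
  "\<exists>\<phi>. bij_betw \<phi> (twisted_conjugacy_classes (W1\<lparr>carrier := H\<rparr>) \<sigma>)
      {double_coset (W1 \<times>\<times> W2) Wc' p Wc | p. p \<in> F} \<and>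
    (\<forall>C \<in> twisted_conjugacy_classes (W1\<lparr>carrier := H\<rparr>) \<sigma>. \<forall>w \<in> C.
      \<phi> C = double_coset (W1 \<times>\<times> W2) Wc' (w1 \<cdot> w, w2) Wc)"
proof -
  let ?O = "\<lambda>z. {z' \<in> H. linked (w1 \<cdot> z, w2) (w1 \<cdot> z', w2)}"
  let ?D = "\<lambda>z. {q. linked (w1 \<cdot> z, w2) q}"
  have eqv: "?O z = ?O z' \<longleftrightarrow> linked (w1 \<cdot> z, w2) (w1 \<cdot> z', w2)"
    "?D z = ?D z' \<longleftrightarrow> linked (w1 \<cdot> z, w2) (w1 \<cdot> z', w2)" if "z \<in> H" "z' \<in> H" for z z'
    using that linked_refl[OF base_carrier] linked_sym[OF base_carrier] linked_trans[OF base_carrier]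
    by blast+
  have cls: "twisted_conjugacy_classes (W1\<lparr>carrier := H\<rparr>) \<sigma> = ?O ` H"
    unfolding twisted_conjugacy_classes_def orbits_def using orbit_eq_linked by auto
  have dcs: "{double_coset (W1 \<times>\<times> W2) Wc' p Wc | p. p \<in> F} = ?D ` H"
  proof -
    have "{q'. linked q q'} = ?D z" if "z \<in> H" "linked (w1 \<cdot> z, w2) q" for z q
      using that linked_sym linked_trans linked_carrier base_carrier[OF that(1)] by blast
    thus ?thesis unfolding double_coset_eq_linked fiber_eq_linked
      using linked_refl[OF base_carrier] by blast
  qed
  have iff: "?O z = ?O z' \<longleftrightarrow> ?D z = ?D z'" if "z \<in> H" "z' \<in> H" for z z'
    using trans[OF eqv(1)[OF that] eqv(2)[OF that, symmetric]] .
  from bij_betw_equal_images[of H ?O ?D, OF iff]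
  obtain \<phi> where \<phi>: "bij_betw \<phi> (?O ` H) (?D ` H) \<and> (\<forall>z\<in>H. \<phi> (?O z) = ?D z)" ..
  \<comment> \<open>The formula holds for every representative of a class, which is what makes the
    bijection the one induced by the map on elements.\<close>
  have val: "\<phi> C = ?D w" if C: "C \<in> ?O ` H" and wC: "w \<in> C" for C w
  proof -
    obtain z where z: "z \<in> H" "C = ?O z" using C by blast
    hence "w \<in> H" "linked (w1 \<cdot> z, w2) (w1 \<cdot> w, w2)" using wC by blast+
    hence "C = ?O w" using eqv(1)[OF z(1)] z(2) by simp
    thus ?thesis using bspec[OF conjunct2[OF \<phi>] \<open>w \<in> H\<close>] by simp
  qed
  show ?thesis unfolding cls dcs unfolding double_coset_eq_linked
    by (rule exI, rule conjI, rule conjunct1[OF \<phi>], intro ballI, rule val)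
qed

end
end

theorem proposition2p4:
  fixes W1 :: "('a, 'k) monoid_scheme" and I1 :: "'a set"
    and W2 :: "('b, 'l) monoid_scheme" and I2 :: "'b set"
    and c c' :: "('a, 'b) triple"
    and w1 :: 'a and w2 :: 'b
  assumes "coxeter_group W1 I1" and "coxeter_group W2 I2"
    and "admissible_triple W1 I1 W2 I2 c" and "admissible_triple W1 I1 W2 I2 c'"
    and "w1 \<in> min_reps_left_quotient W1 I1 (fst c')"
    and "w2 \<in> min_reps_right_quotient W2 I2 (fst (snd c))"
  shows
    "let F = fiber W1 I1 W2 I2 c c' w1 w2;
         H = parabolic W1 (stable_subset W1 W2 c c' w1 w2);
         \<sigma> = twist W1 W2 c c' w1 w2;
         Wc = triple_graph W1 c;
         Wc' = triple_graph W1 c'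
     in F = Wc' <#>\<^bsub>W1 \<times>\<times> W2\<^esub> ((w1 <#\<^bsub>W1\<^esub> carrier H) \<times> {w2}) <#>\<^bsub>W1 \<times>\<times> W2\<^esub> Wc
        \<and> \<sigma> \<in> iso H H
        \<and> (\<exists>\<phi>. bij_betw \<phi> (twisted_conjugacy_classes H \<sigma>)
                  {double_coset (W1 \<times>\<times> W2) Wc' p Wc | p. p \<in> F}
              \<and> (\<forall>C \<in> twisted_conjugacy_classes H \<sigma>. \<forall>w \<in> C.
                    \<phi> C = double_coset (W1 \<times>\<times> W2) Wc' (w1 \<otimes>\<^bsub>W1\<^esub> w, w2) Wc))"
proof -
  obtain J1 J2 \<delta> where c: "c = (J1, J2, \<delta>)" by (cases c)
  obtain J1' J2' \<delta>' where c': "c' = (J1', J2', \<delta>')" by (cases c')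
  interpret triple_pair W1 I1 W2 I2 J1 J2 \<delta> J1' J2' \<delta>'
    using assms(1-4) unfolding c c'
    by (auto simp: triple_pair_def parabolic_iso_def parabolic_iso_axioms_def)
  have w: "w1 \<in> A.left_reps J1'" "w2 \<in> B.right_reps J2" using assms(5,6) by (simp_all add: c c')
  show ?thesis
    unfolding Let_def c c' stable_subset_eq_largest
    using fiber_eq_linked[OF w] twist_iso[OF w] twisted_classes_bij[OF w]
    by (simp add: set_mult_eq_linked del: twist.simps triple_graph.simps)
qed

end
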